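(* Let $X=\{x_1,\dots,x_n\}$ be a data set of $n$ tuples $x_i\in U^m$. Consider the $\epsilon$-separation key filter problem on $X$, and consider algorithms for it that are based on uniform sampling. If $n\ge Km/\epsilon$ for some sufficiently large absolute constant $K$, then: (1) $\Theta\!\left(\frac{m}{\sqrt{\epsilon}}\right)$ sampled tuples are sufficient and necessary so that the failure probability satisfies $\delta\le e^{-m}$; furthermore, with this many samples the query time is $O\!\left(\frac{m|A|}{\sqrt{\epsilon}}\log\frac{m}{\epsilon}\right)$, where $A$ is the queried subset of coordinates; (2) $\Omega\!\left(\sqrt{\frac{\log m}{\epsilon}}\right)$ sampled tuples are necessary so that $\delta$ is a constant.
   Context: A subset of coordinates $A\subseteq[m]$ separates tuples $x_i,x_j$ if they differ in at least one coordinate in $A$. $A$ is a key if it separates all $\binom{n}{2}$ pairs of tuples, and $A$ is bad if it separates fewer than $(1-\epsilon)\binom{n}{2}$ pairs. The $\epsilon$-separation key filter problem asks for an algorithm that, given a query $A\subseteq[m]$, rejects if $A$ is bad and accepts if $A$ is a key (if $A$ is neither, either answer is allowed); it succeeds with probability at least $1-\delta$ in the "for all" sense: $\Pr[\forall A\subseteq[m],\ \text{the algorithm is correct on } A]\ge 1-\delta$. An algorithm based on uniform sampling keeps only a set of tuples drawn uniformly at random from $X$ and answers queries using only these tuples. The query time is the time to answer a given $A$. It is assumed that the values in $U$ admit a total order and that comparing two values of $U$ takes constant time.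
   Formalization: The necessity and query-time bounds are for ε ≤ ε₀ with any fixed ε₀ < 1, constants depending on ε₀ (as ε → 1 two samples can suffice); necessity assumes U has at least n values, part (2) m large; query time is for nonempty A. *)

theory Defs
  imports "HOL-Probability.Probability" "HOL-Library.Time_Functions"
begin

section \<open>Keys and bad sets of coordinates\<close>

text \<open>
  An \<open>m\<close>-tuple over \<open>U\<close> is an extensional function on the coordinates \<open>{1..m}\<close>, and a data set
  of \<open>n\<close> tuples is a family indexed by \<open>{1..n}\<close>; repeated tuples are allowed.
\<close>

type_synonym 'u tuple = "nat \<Rightarrow> 'u"

definition data_sets :: "'u set \<Rightarrow> nat \<Rightarrow> nat \<Rightarrow> (nat \<Rightarrow> 'u tuple) set" where
  "data_sets U m n = {1..n} \<rightarrow>\<^sub>E ({1..m} \<rightarrow>\<^sub>E U)"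

definition separates :: "nat set \<Rightarrow> 'u tuple \<Rightarrow> 'u tuple \<Rightarrow> bool" where
  "separates A s t \<longleftrightarrow> (\<exists>a\<in>A. s a \<noteq> t a)"

definition is_key :: "nat \<Rightarrow> (nat \<Rightarrow> 'u tuple) \<Rightarrow> nat set \<Rightarrow> bool" where
  "is_key n x A \<longleftrightarrow> (\<forall>i\<in>{1..n}. \<forall>j\<in>{1..n}. i < j \<longrightarrow> separates A (x i) (x j))"

definition is_bad :: "real \<Rightarrow> nat \<Rightarrow> (nat \<Rightarrow> 'u tuple) \<Rightarrow> nat set \<Rightarrow> bool" where
  "is_bad \<epsilon> n x A \<longleftrightarrow>
     real (card {(i, j). 1 \<le> i \<and> i < j \<and> j \<le> n \<and> separates A (x i) (x j)})
       < (1 - \<epsilon>) * real (n choose 2)"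

section \<open>Filters based on uniform sampling\<close>

text \<open>
  An answer function maps a query to \<^const>\<open>True\<close> (accept) or \<^const>\<open>False\<close> (reject).
  A filter sees only the list of sampled tuples (not their indices in the data set) and may use
  further randomness, so that it returns a random answer function. The randomness is shared
  by all queries, as the ``for all'' success guarantee requires.
\<close>

type_synonym 'u filter_alg = "'u tuple list \<Rightarrow> (nat set \<Rightarrow> bool) pmf"

definition correct_answer ::
    "real \<Rightarrow> nat \<Rightarrow> (nat \<Rightarrow> 'u tuple) \<Rightarrow> nat set \<Rightarrow> bool \<Rightarrow> bool" where
  "correct_answer \<epsilon> n x A accept \<longleftrightarrow>
     (is_bad \<epsilon> n x A \<longrightarrow> \<not> accept) \<and> (is_key n x A \<longrightarrow> accept)"

text \<open>
  Uniform sampling of \<open>r \<le> n\<close> tuples without replacement: a uniformly random \<open>r\<close>-element set of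
  indices, listed in uniformly random order.
\<close>

definition index_samples :: "nat \<Rightarrow> nat \<Rightarrow> nat list set" where
  "index_samples n r = {js. length js = r \<and> distinct js \<and> set js \<subseteq> {1..n}}"

definition answers_pmf ::
    "'u filter_alg \<Rightarrow> nat \<Rightarrow> nat \<Rightarrow> (nat \<Rightarrow> 'u tuple) \<Rightarrow> (nat set \<Rightarrow> bool) pmf" where
  "answers_pmf alg n r x = bind_pmf (pmf_of_set (index_samples n r)) (\<lambda>js. alg (map x js))"

definition solves_key_filter ::
    "'u filter_alg \<Rightarrow> nat \<Rightarrow> 'u set \<Rightarrow> nat \<Rightarrow> nat \<Rightarrow> real \<Rightarrow> real \<Rightarrow> bool" where
  "solves_key_filter alg r U m n \<epsilon> \<delta> \<longleftrightarrow>
     (\<forall>x\<in>data_sets U m n.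
        measure_pmf.prob (answers_pmf alg n r x)
          {ans. \<forall>A\<subseteq>{1..m}. correct_answer \<epsilon> n x A (ans A)} \<ge> 1 - \<delta>)"

section \<open>The sorting-based query algorithm\<close>

text \<open>
  The sampled tuples are merge-sorted lexicographically with respect to the queried coordinates,
  and the query is accepted iff no two neighbours in the sorted list agree on all of them.
  The query is represented by a list of coordinates.
\<close>

fun proj_le :: "nat list \<Rightarrow> 'u::linorder tuple \<Rightarrow> 'u tuple \<Rightarrow> bool" where
  "proj_le [] s t = True"
| "proj_le (a # as) s t =
     (if s a < t a then True else if s a = t a then proj_le as s t else False)"

fun proj_eq :: "nat list \<Rightarrow> 'u tuple \<Rightarrow> 'u tuple \<Rightarrow> bool" where
  "proj_eq [] s t = True"
| "proj_eq (a # as) s t = (if s a = t a then proj_eq as s t else False)"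

fun proj_merge :: "nat list \<Rightarrow> 'u::linorder tuple list \<Rightarrow> 'u tuple list \<Rightarrow> 'u tuple list" where
  "proj_merge as [] ts = ts"
| "proj_merge as ss [] = ss"
| "proj_merge as (s # ss) (t # ts) =
     (if proj_le as s t then s # proj_merge as ss (t # ts) else t # proj_merge as (s # ss) ts)"

fun proj_sort :: "nat list \<Rightarrow> 'u::linorder tuple list \<Rightarrow> 'u tuple list" where
  "proj_sort as ss =
     (let k = length ss in
      if k \<le> 1 then ss
      else proj_merge as (proj_sort as (take (k div 2) ss)) (proj_sort as (drop (k div 2) ss)))"

declare proj_sort.simps [simp del]

fun adjacent_distinct :: "nat list \<Rightarrow> 'u tuple list \<Rightarrow> bool" where
  "adjacent_distinct as [] = True"
| "adjacent_distinct as [s] = True"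
| "adjacent_distinct as (s # t # ts) =
     (if proj_eq as s t then False else adjacent_distinct as (t # ts))"

definition key_query :: "nat list \<Rightarrow> 'u::linorder tuple list \<Rightarrow> bool" where
  "key_query as ss = adjacent_distinct as (proj_sort as ss)"

definition sort_filter :: "'u::linorder filter_alg" where
  "sort_filter ss = return_pmf (\<lambda>A. key_query (sorted_list_of_set A) ss)"

section \<open>Query time\<close>

text \<open>
  Step counts follow the convention of \<^theory>\<open>HOL-Library.Time_Functions\<close>: every function call
  costs one step, in addition to the steps of the calls it makes. Every comparison of two values
  of \<open>U\<close>, including the access to the two tuple entries, is charged one further step.
  Arithmetic on list lengths is covered by the step of the surrounding call.
\<close>

fun T_proj_le :: "nat list \<Rightarrow> 'u::linorder tuple \<Rightarrow> 'u tuple \<Rightarrow> nat" where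
  "T_proj_le [] s t = 1"
| "T_proj_le (a # as) s t =
     1 + (if s a < t a then 1 else 2 + (if s a = t a then T_proj_le as s t else 0))"

fun T_proj_eq :: "nat list \<Rightarrow> 'u tuple \<Rightarrow> 'u tuple \<Rightarrow> nat" where
  "T_proj_eq [] s t = 1"
| "T_proj_eq (a # as) s t = 1 + 1 + (if s a = t a then T_proj_eq as s t else 0)"

fun T_proj_merge :: "nat list \<Rightarrow> 'u::linorder tuple list \<Rightarrow> 'u tuple list \<Rightarrow> nat" where
  "T_proj_merge as [] ts = 1"
| "T_proj_merge as ss [] = 1"
| "T_proj_merge as (s # ss) (t # ts) =
     1 + T_proj_le as s t +
     (if proj_le as s t then T_proj_merge as ss (t # ts) else T_proj_merge as (s # ss) ts)"

fun T_proj_sort :: "nat list \<Rightarrow> 'u::linorder tuple list \<Rightarrow> nat" where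
  "T_proj_sort as ss =
     1 + T_length ss +
     (let k = length ss in
      if k \<le> 1 then 0
      else T_take (k div 2) ss + T_drop (k div 2) ss +
        T_proj_sort as (take (k div 2) ss) + T_proj_sort as (drop (k div 2) ss) +
        T_proj_merge as (proj_sort as (take (k div 2) ss)) (proj_sort as (drop (k div 2) ss)))"

declare T_proj_sort.simps [simp del]

fun T_adjacent_distinct :: "nat list \<Rightarrow> 'u tuple list \<Rightarrow> nat" where
  "T_adjacent_distinct as [] = 1"
| "T_adjacent_distinct as [s] = 1"
| "T_adjacent_distinct as (s # t # ts) =
     1 + T_proj_eq as s t + (if proj_eq as s t then 0 else T_adjacent_distinct as (t # ts))"

definition T_key_query :: "nat list \<Rightarrow> 'u::linorder tuple list \<Rightarrow> nat" where
  "T_key_query as ss = 1 + T_proj_sort as ss + T_adjacent_distinct as (proj_sort as ss)"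

end

theory Submission
  imports Defs
begin

text \<open>
Sufficiency: a query \<open>A\<close> partitions the tuples into classes of size \<open>n\<^sub>c\<close>, and a bad \<open>A\<close> is accepted
only if the sample meets every class at most once. Replacing the sample of size \<open>r\<close> by independent
inclusion with probability \<open>\<theta> = r / (2 * n)\<close> costs a factor \<open>2\<close> and turns this probability into the
product over the classes of the probabilities that a binomial variable is at most \<open>1\<close>, each at most
\<open>exp (- y\<^sup>2 / (2 * (1 + y)))\<close> for \<open>y = (n\<^sub>c - 1) * \<theta>\<close>. As the \<open>y\<^sup>2\<close> sum to order \<open>r\<^sup>2 * \<epsilon>\<close>, the exponents sum to
order \<open>r * sqrt \<epsilon>\<close>, whether or not one \<open>y\<close> exceeds \<open>r * sqrt \<epsilon>\<close>; a union bound over all \<open>A\<close> finishes.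

Necessity: let every coordinate, by a fair coin, either be a key or agree on a random set of about
\<open>sqrt \<epsilon> * n\<close> tuples, which makes it bad. A sample that avoids this set, an event of probability
\<open>p \<ge> exp (- O(r * sqrt \<epsilon>))\<close>, does not reveal the coin, so any filter succeeds with probability at most
\<open>(1 - p / 2) ^ m\<close>. This gives both bounds; for constant \<open>\<delta>\<close> it even gives order \<open>ln m / sqrt \<epsilon>\<close>, which
dominates \<open>sqrt (ln m / \<epsilon>)\<close>.
\<close>

section \<open>The sorting-based query\<close>

lemma proj_eq_iff: "proj_eq as s t \<longleftrightarrow> map s as = map t as"
  by (induction as) auto

lemma proj_le_total: "proj_le as s t \<or> proj_le as t s"
  by (induction as) auto

lemma proj_le_antisym: "proj_le as s t \<Longrightarrow> proj_le as t s \<Longrightarrow> proj_eq as s t"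
  by (induction as) (auto split: if_splits)

lemma proj_le_trans: "proj_le as s t \<Longrightarrow> proj_le as t v \<Longrightarrow> proj_le as s v"
  by (induction as) (auto split: if_splits)

lemma proj_eq_imp_le: "proj_eq as s t \<Longrightarrow> proj_le as t s"
  by (induction as) (auto split: if_splits)

lemma mset_proj_merge: "mset (proj_merge as ss ts) = mset ss + mset ts"
  by (induction as ss ts rule: proj_merge.induct) auto

lemma mset_proj_sort: "mset (proj_sort as ss) = mset ss"
proof (induction as ss rule: proj_sort.induct)
  case (1 as ss)
  show ?case
  proof (cases "length ss \<le> 1")
    case True
    then show ?thesis by (simp add: proj_sort.simps)
  next
    case False
    then show ?thesis
      using 1[OF refl False] mset_append[of "take (length ss div 2) ss" "drop (length ss div 2) ss"]
      by (subst proj_sort.simps) (simp add: mset_proj_merge Let_def del: mset_append)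
  qed
qed

lemma length_proj_sort: "length (proj_sort as ss) = length ss"
  by (metis mset_proj_sort size_mset)

lemma sorted_proj_merge:
  assumes "sorted_wrt (proj_le as) ss" "sorted_wrt (proj_le as) ts"
  shows "sorted_wrt (proj_le as) (proj_merge as ss ts)"
  using assms
proof (induction as ss ts rule: proj_merge.induct)
  case (3 as s ss t ts)
  have set: "set (proj_merge as xs ys) = set xs \<union> set ys" for xs ys
    by (metis mset_proj_merge set_mset_mset set_mset_union)
  show ?case
    using 3 proj_le_total[of as s t] by (auto simp: set intro: proj_le_trans)
qed auto

lemma sorted_proj_sort: "sorted_wrt (proj_le as) (proj_sort as ss)"
proof (induction as ss rule: proj_sort.induct)
  case (1 as ss)
  show ?case
  proof (cases "length ss \<le> 1")
    case True
    then show ?thesis by (cases ss) (auto simp: proj_sort.simps)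
  next
    case False
    then show ?thesis
      using 1[OF refl False] by (subst proj_sort.simps) (simp add: sorted_proj_merge Let_def)
  qed
qed

text \<open>In a sorted list equal projections are contiguous: if \<open>s\<close> agreed with some
  \<open>v\<close> beyond its neighbour \<open>t\<close>, then \<open>t\<close> would be below
  \<open>v\<close> and hence below \<open>s\<close>, and antisymmetry would make \<open>s\<close>
  agree with \<open>t\<close>.\<close>

lemma adjacent_distinct_iff:
  assumes "sorted_wrt (proj_le as) ss"
  shows "adjacent_distinct as ss \<longleftrightarrow> distinct (map (\<lambda>s. map s as) ss)"
  using assms
proof (induction as ss rule: adjacent_distinct.induct)
  case (3 as s t ts)
  have "\<not> proj_eq as s v" if "\<not> proj_eq as s t" "v \<in> set ts" for v
    using that 3(2) proj_le_antisym[of as s t] proj_eq_imp_le[of as s v]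
      proj_le_trans[of as t v s] by auto
  then show ?case
    using 3 by (auto simp: proj_eq_iff simp del: map_eq_conv)
qed auto

text \<open>Distinctness of projections depends only on the multiset of tuples, so sorting drops out
  and only collisions in the sample matter.\<close>

lemma key_query_iff: "key_query as ss \<longleftrightarrow> distinct (map (\<lambda>s. map s as) ss)"
  unfolding key_query_def adjacent_distinct_iff[OF sorted_proj_sort]
  by (rule mset_eq_imp_distinct_iff) (simp add: mset_proj_sort)

section \<open>Step counts of the query\<close>

lemma T_proj_le_le: "T_proj_le as s t \<le> 3 * length as + 1"
  by (induction as) auto

lemma T_proj_eq_le: "T_proj_eq as s t \<le> 2 * length as + 1"
  by (induction as) auto

lemma T_proj_merge_le: "T_proj_merge as ss ts \<le> (3 * length as + 2) * (length ss + length ts) + 1"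
proof (induction as ss ts rule: T_proj_merge.induct)
  case (3 as s ss t ts)
  then show ?case using T_proj_le_le[of as s t] by auto
qed auto

lemma T_adjacent_distinct_le: "T_adjacent_distinct as ss \<le> (2 * length as + 2) * length ss + 1"
proof (induction as ss rule: T_adjacent_distinct.induct)
  case (3 as s t ts)
  then show ?case using T_proj_eq_le[of as s t] by auto
qed auto

text \<open>The larger half of a list of length \<open>k \<ge> 2\<close> has length at most \<open>2 * k / 3\<close>,
  so the recursion depth is at most the logarithm of \<open>k\<close> to base \<open>3 / 2\<close>.\<close>

lemma T_proj_sort_le:
  assumes "ss \<noteq> []"
  shows "real (T_proj_sort as ss) \<le>
    (3 * real (length as) + 8) * real (length ss) * (1 + log (3/2) (real (length ss)))"
  using assms
proof (induction as ss rule: T_proj_sort.induct)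
  case (1 as ss)
  define k where "k = length ss"
  define b where "b = 3 * real (length as) + 8"
  have k: "k \<ge> 1" using 1(3) by (simp add: k_def Suc_leI)
  have b: "b \<ge> 8" by (simp add: b_def)
  show ?case
  proof (cases "k \<le> 1")
    case True
    then have "k = 1" using k by simp
    then show ?thesis by (simp add: T_proj_sort.simps k_def T_length)
  next
    case False
    define k1 where "k1 = k div 2"
    define k2 where "k2 = k - k div 2"
    define ls where "ls = take k1 ss"
    define rs where "rs = drop k1 ss"
    have len: "length ls = k1" "length rs = k2"
      by (auto simp: ls_def rs_def k_def k1_def k2_def)
    have pos: "k1 \<ge> 1" "k2 \<ge> 1" and small: "3 * k1 \<le> 2 * k" "3 * k2 \<le> 2 * k" and sum: "k1 + k2 = k"
      using False by (auto simp: k1_def k2_def)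
    define l where "l = log (3/2) (real k)"
    \<comment> \<open>Descending one level lowers the logarithm by at least \<open>1\<close>, which
      pays for the linear work of the current level.\<close>
    have half: "1 + log (3/2) (real j) \<le> l" if "j \<ge> 1" "3 * j \<le> 2 * k" for j
    proof -
      have "1 + log (3/2) (real j) = log (3/2) (3/2 * real j)"
        using that by (subst log_mult) auto
      also have "\<dots> \<le> l" unfolding l_def
        using that by (subst log_le_cancel_iff) auto
      finally show ?thesis .
    qed
    have step: "real (T_proj_sort as xs) \<le> b * real (length xs) * l"
      if "real (T_proj_sort as xs) \<le> b * real (length xs) * (1 + log (3/2) (real (length xs)))"
        "length xs \<ge> 1" "3 * length xs \<le> 2 * k" for xs
      using that(1) mult_left_mono[OF half[OF that(2,3)], of "b * real (length xs)"] b
      by (meson mult_nonneg_nonneg of_nat_0_le_iff order_trans zero_le_numeral)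
    have IH: "real (T_proj_sort as ls) \<le> b * real k1 * l" "real (T_proj_sort as rs) \<le> b * real k2 * l"
    proof -
      have "ls \<noteq> []" "rs \<noteq> []" using len pos by auto
      then have "real (T_proj_sort as ls) \<le> b * real (length ls) * (1 + log (3/2) (real (length ls)))"
        "real (T_proj_sort as rs) \<le> b * real (length rs) * (1 + log (3/2) (real (length rs)))"
        using 1(1,2)[OF refl, folded k_def, OF False] unfolding ls_def rs_def k1_def b_def by blast+
      then show "real (T_proj_sort as ls) \<le> b * real k1 * l" "real (T_proj_sort as rs) \<le> b * real k2 * l"
        using step[of ls] step[of rs] len pos small by auto
    qed
    have "T_proj_sort as ss = 1 + (k + 1) + (k1 + 1) + (k1 + 1) + T_proj_sort as ls +
        T_proj_sort as rs + T_proj_merge as (proj_sort as ls) (proj_sort as rs)"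
      using False
      by (subst T_proj_sort.simps)
        (auto simp: Let_def T_length T_take T_drop k_def k1_def ls_def rs_def)
    also have "\<dots> \<le> 2 * k + 5 + T_proj_sort as ls + T_proj_sort as rs + (3 * length as + 2) * k"
      using T_proj_merge_le[of as "proj_sort as ls" "proj_sort as rs"]
      by (simp add: length_proj_sort len sum) (simp add: k1_def)
    finally have "real (T_proj_sort as ss) \<le>
        real (2 * k + 5 + T_proj_sort as ls + T_proj_sort as rs + (3 * length as + 2) * k)"
      by (simp only: of_nat_le_iff)
    \<comment> \<open>The constant \<open>8\<close> is \<open>2 + 2 + 4\<close>: the additive
      \<open>5\<close> is at most \<open>4 * k\<close> because \<open>k \<ge> 2\<close>.\<close>
    also have "\<dots> \<le> b * real k + b * real k1 * l + b * real k2 * l"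
      using IH False by (simp add: b_def algebra_simps)
    also have "\<dots> = b * real k * (1 + l)"
      by (simp add: sum[symmetric] algebra_simps)
    finally show ?thesis by (simp add: b_def k_def l_def)
  qed
qed

text \<open>Non-emptiness makes \<open>k\<close>, \<open>L\<close> and the logarithmic factor
  \<open>l\<close> at least \<open>1\<close>, so lower-order terms are absorbed into
  \<open>L * k * l\<close>; the constant is \<open>17 = 3 + 8 + 6\<close>.\<close>

lemma T_key_query_le:
  assumes "ss \<noteq> []" "as \<noteq> []"
  shows "real (T_key_query as ss) \<le>
    17 * real (length as) * real (length ss) * (1 + log (3/2) (real (length ss)))"
proof -
  define k L where "k = real (length ss)" and "L = real (length as)"
  have "length ss \<noteq> 0" "length as \<noteq> 0" using assms by auto
  then have kL: "k \<ge> 1" "L \<ge> 1" unfolding k_def L_def by linarith+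
  define l where "l = 1 + log (3/2) k"
  have l: "l \<ge> 1" using kL by (simp add: l_def)
  have "real (T_adjacent_distinct as (proj_sort as ss)) \<le> (2 * L + 2) * k + 1"
    using of_nat_mono[OF T_adjacent_distinct_le[of as "proj_sort as ss"], where 'a = real]
    by (simp add: k_def L_def length_proj_sort algebra_simps)
  then have "real (T_key_query as ss) \<le> (3 * L + 8) * k * l + ((2 * L + 2) * k + 2)"
    using T_proj_sort_le[OF assms(1), of as]
    by (simp add: T_key_query_def k_def L_def l_def)
  also have "(2 * L + 2) * k + 2 \<le> (6 * L) * k"
  proof -
    have "1 \<le> L * k" using mult_mono[OF kL(2) kL(1)] kL by simp
    moreover have "k \<le> L * k" using kL by simp
    ultimately show ?thesis by (simp add: algebra_simps)
  qed
  also have "(6 * L) * k \<le> (6 * L) * k * l"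
    using l kL by simp
  also have "(3 * L + 8) * k * l + (6 * L) * k * l \<le> 17 * L * k * l"
  proof -
    have "k * l \<le> L * (k * l)" using kL l by simp
    then show ?thesis by (simp add: algebra_simps)
  qed
  finally show ?thesis by (simp add: k_def L_def l_def)
qed

section \<open>A birthday bound\<close>

text \<open>\<open>f\<close> is read as a colouring of \<open>V\<close>. When it projects indices to
  the queried coordinates, the rainbow sets are the samples on which the query accepts.\<close>

definition rainbow_sets :: "('a \<Rightarrow> 'b) \<Rightarrow> 'a set \<Rightarrow> nat \<Rightarrow> 'a set set" where
  "rainbow_sets f V k = {S. S \<subseteq> V \<and> card S = k \<and> inj_on f S}"

text \<open>Every set of size \<open>k\<close> has \<open>fact k\<close> orderings; this passes from
  ordered samples to sets.\<close>

lemma card_distinct_lists: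
  assumes "finite V"
  shows "card {xs. length xs = k \<and> distinct xs \<and> set xs \<subseteq> V \<and> P (set xs)} =
    fact k * card {S. S \<subseteq> V \<and> card S = k \<and> P S}"
proof -
  let ?F = "{S. S \<subseteq> V \<and> card S = k \<and> P S}"
  have fin: "finite ?F" using assms by auto
  have "{xs. length xs = k \<and> distinct xs \<and> set xs \<subseteq> V \<and> P (set xs)} =
      (\<Union>S\<in>?F. permutations_of_set S)"
    unfolding permutations_of_set_def using distinct_card by fastforce
  also have "card \<dots> = (\<Sum>S\<in>?F. card (permutations_of_set S))"
  proof (rule card_UN_disjoint)
    show "\<forall>S\<in>?F. finite (permutations_of_set S)" by simp
  qed (use fin in \<open>auto simp: permutations_of_set_def\<close>)
  also have "\<dots> = (\<Sum>S\<in>?F. fact k)"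
    using finite_subset[OF _ assms] by (intro sum.cong) auto
  finally show ?thesis by simp
qed

text \<open>Double counting: a rainbow set of size \<open>k + 1\<close> with a marked element
  \<open>v\<close> is determined by \<open>S - {v}\<close>, again rainbow, and by \<open>v\<close>,
  one of the \<open>card V - k\<close> elements outside it.\<close>

lemma card_rainbow_sets_Suc:
  assumes "finite V"
  shows "Suc k * card (rainbow_sets f V (Suc k)) \<le> (card V - k) * card (rainbow_sets f V k)"
proof -
  let ?P = "Sigma (rainbow_sets f V (Suc k)) (\<lambda>S. S)"
  let ?Q = "Sigma (rainbow_sets f V k) (\<lambda>S. V - S)"
  have fin: "finite (rainbow_sets f V j)" for j
    using assms by (auto simp: rainbow_sets_def)
  have finS: "finite S" if "S \<subseteq> V" for S
    using that assms finite_subset by blast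
  have "Suc k * card (rainbow_sets f V (Suc k)) = card ?P"
    using fin by (subst card_SigmaI) (auto simp: rainbow_sets_def intro: finS)
  also have "\<dots> \<le> card ?Q"
  proof (rule card_inj_on_le[where f = "\<lambda>(S, v). (S - {v}, v)"])
    show "inj_on (\<lambda>(S, v). (S - {v}, v)) ?P"
      by (auto simp: inj_on_def)
    show "(\<lambda>(S, v). (S - {v}, v)) ` ?P \<subseteq> ?Q"
      using finS by (auto simp: rainbow_sets_def inj_on_def)
    show "finite ?Q" using fin assms by auto
  qed
  also have "\<dots> = (\<Sum>S\<in>rainbow_sets f V k. card V - k)"
    using fin assms
    by (subst card_SigmaI) (auto simp: rainbow_sets_def card_Diff_subset finS)
  finally show ?thesis by (simp add: mult.commute)
qed

text \<open>Binomial coefficients satisfy the preceding recursion with equality, so the ratio cannot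
  grow. This allows the fixed sample size to be replaced by a random one.\<close>

lemma rainbow_fraction_antimono:
  assumes "finite V" "j \<le> k" "k \<le> card V"
  shows "real (card (rainbow_sets f V k)) / real (card V choose k)
    \<le> real (card (rainbow_sets f V j)) / real (card V choose j)"
  using assms(2,3)
proof (induction rule: dec_induct)
  case (step i)
  let ?R = "\<lambda>i. real (card (rainbow_sets f V i))" and ?C = "\<lambda>i. real (card V choose i)"
  have "Suc i * (card V choose Suc i) = (card V - i) * (card V choose i)"
    using binomial_absorb_comp[of "card V" i] binomial_absorption[of i "card V"] step by simp
  then have C: "real (Suc i) * ?C (Suc i) = real (card V - i) * ?C i"
    by (metis of_nat_mult)
  have R: "real (Suc i) * ?R (Suc i) \<le> real (card V - i) * ?R i"
    using card_rainbow_sets_Suc[OF assms(1), of i f]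
    by (simp only: of_nat_le_iff flip: of_nat_mult)
  have pos: "?C i > 0" "?C (Suc i) > 0" "real (card V - i) > 0" using step by auto
  have "?R (Suc i) / ?C (Suc i) = real (Suc i) * ?R (Suc i) / (real (Suc i) * ?C (Suc i))"
    by (simp del: of_nat_Suc)
  also have "\<dots> \<le> real (card V - i) * ?R i / (real (Suc i) * ?C (Suc i))"
    using R pos by (intro divide_right_mono) auto
  also have "\<dots> = ?R i / ?C i"
    using pos unfolding C by simp
  finally show ?case using step by simp
qed simp

text \<open>Generating function by size: a rainbow set independently picks nothing or a single
  element from each colour class, so a class of size \<open>N\<close> contributes the factor
  \<open>1 + N * w\<close>.\<close>

lemma sum_rainbow_sets:
  fixes w :: real
  assumes "finite C" "finite V" "f ` V \<subseteq> C"
  shows "(\<Sum>S | S \<subseteq> V \<and> inj_on f S. w ^ card S) = (\<Prod>c\<in>C. 1 + real (card {v\<in>V. f v = c}) * w)"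
  using assms
proof (induction C arbitrary: V rule: finite_induct)
  case empty
  have "{S. S \<subseteq> {} \<and> inj_on f S} = {{}}" by auto
  then show ?case using empty by simp
next
  case (insert c C)
  define W D where "W = {v\<in>V. f v \<noteq> c}" and "D = {v\<in>V. f v = c}"
  have fin: "finite W" "finite D" using insert by (auto simp: W_def D_def)
  let ?I = "\<lambda>V. {S. S \<subseteq> V \<and> inj_on f S}"
  have finI: "finite S" if "S \<subseteq> V" for S using that insert finite_subset by blast
  have split: "(\<Sum>S\<in>?I V. w ^ card S) = (\<Sum>S\<in>?I W. w ^ card S) * (\<Sum>T\<in>?I D. w ^ card T)"
    unfolding sum_product sum.cartesian_product
  proof (rule sum.reindex_bij_witness[of _ "\<lambda>(S, T). S \<union> T" "\<lambda>S. (S \<inter> W, S \<inter> D)"])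
    fix S assume S: "S \<in> ?I V"
    then have "S = (S \<inter> W) \<union> (S \<inter> D)" by (auto simp: W_def D_def)
    moreover have "card ((S \<inter> W) \<union> (S \<inter> D)) = card (S \<inter> W) + card (S \<inter> D)"
      using fin by (intro card_Un_disjoint) (auto simp: W_def D_def)
    ultimately have "card S = card (S \<inter> W) + card (S \<inter> D)" by simp
    then show "(case (S \<inter> W, S \<inter> D) of (S, T) \<Rightarrow> w ^ card S * w ^ card T) = w ^ card S"
      by (simp add: power_add)
    show "(case (S \<inter> W, S \<inter> D) of (S, T) \<Rightarrow> S \<union> T) = S"
      using \<open>S = (S \<inter> W) \<union> (S \<inter> D)\<close> by simp
    show "(S \<inter> W, S \<inter> D) \<in> ?I W \<times> ?I D" using S by (auto simp: inj_on_def)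
  next
    fix p assume "p \<in> ?I W \<times> ?I D"
    then obtain S T where p: "p = (S, T)" "S \<subseteq> W" "T \<subseteq> D" "inj_on f S" "inj_on f T"
      by auto
    have "f s \<noteq> f t" if "s \<in> S" "t \<in> T" for s t
      using that p by (auto simp: W_def D_def)
    then have "inj_on f (S \<union> T)"
      using p by (fastforce simp: inj_on_Un)
    then show "(case p of (S, T) \<Rightarrow> S \<union> T) \<in> ?I V"
      using p by (auto simp: W_def D_def)
    show "((case p of (S, T) \<Rightarrow> S \<union> T) \<inter> W, (case p of (S, T) \<Rightarrow> S \<union> T) \<inter> D) = p"
      using p by (auto simp: W_def D_def)
  qed
  have ID: "?I D = insert {} ((\<lambda>v. {v}) ` D)"
  proof (intro equalityI subsetI)
    fix S assume S: "S \<in> ?I D"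
    then have "s = t" if "s \<in> S" "t \<in> S" for s t
      using that by (auto simp: D_def inj_on_def)
    then have "S = {} \<or> (\<exists>v. S = {v})" by blast
    then show "S \<in> insert {} ((\<lambda>v. {v}) ` D)" using S by auto
  qed auto
  have D: "(\<Sum>T\<in>?I D. w ^ card T) = 1 + real (card D) * w"
    unfolding ID using fin by (subst sum.insert) (auto simp: sum.reindex inj_on_def)
  have "(\<Sum>S\<in>?I W. w ^ card S) = (\<Prod>d\<in>C. 1 + real (card {v\<in>W. f v = d}) * w)"
    using insert fin by (intro insert.IH) (auto simp: W_def)
  also have "\<dots> = (\<Prod>d\<in>C. 1 + real (card {v\<in>V. f v = d}) * w)"
  proof (rule prod.cong)
    fix d assume "d \<in> C"
    then have "{v\<in>W. f v = d} = {v\<in>V. f v = d}" using insert by (auto simp: W_def)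
    then show "1 + real (card {v\<in>W. f v = d}) * w = 1 + real (card {v\<in>V. f v = d}) * w" by simp
  qed simp
  finally have W: "(\<Sum>S\<in>?I W. w ^ card S) = (\<Prod>d\<in>C. 1 + real (card {v\<in>V. f v = d}) * w)" .
  show ?case using insert.hyps unfolding split W D by (simp add: D_def mult.commute)
qed

text \<open>After taking logarithms, the difference \<open>g\<close> of the two sides vanishes at
  \<open>0\<close> and has a nonnegative derivative. The exponent is quadratic for small
  \<open>y\<close> and linear for large \<open>y\<close>; both regimes are used later.\<close>

lemma one_plus_mult_exp_le:
  fixes y :: real
  assumes "y \<ge> 0"
  shows "(1 + y) * exp (- y) \<le> exp (- (y\<^sup>2 / (2 * (1 + y))))"
proof -
  define g where "g = (\<lambda>y::real. y - y\<^sup>2 / (2 * (1 + y)) - ln (1 + y))"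
  have "g 0 \<le> g y"
  proof (rule DERIV_nonneg_imp_nondecreasing[OF assms])
    fix t :: real assume t: "0 \<le> t" "t \<le> y"
    have "DERIV g t :> 1 - (2 * t * (2 * (1 + t)) - t\<^sup>2 * 2) / (2 * (1 + t))\<^sup>2 - 1 / (1 + t)"
      unfolding g_def using t
      by (auto intro!: derivative_eq_intros simp: power2_eq_square)
    also have "1 - (2 * t * (2 * (1 + t)) - t\<^sup>2 * 2) / (2 * (1 + t))\<^sup>2 - 1 / (1 + t)
        = t\<^sup>2 / (2 * (1 + t)\<^sup>2)"
      using t by (simp add: divide_simps) algebra
    finally show "\<exists>z. DERIV g t :> z \<and> 0 \<le> z" by force
  qed
  then have "ln (1 + y) - y \<le> - (y\<^sup>2 / (2 * (1 + y)))" by (simp add: g_def)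
  then have "exp (ln (1 + y) - y) \<le> exp (- (y\<^sup>2 / (2 * (1 + y))))" by simp
  then show ?thesis using assms by (simp add: exp_diff exp_minus divide_inverse)
qed

text \<open>The left-hand side is the probability that a binomial variable is at most \<open>1\<close>.\<close>

lemma binomial_at_most_one_le:
  fixes \<theta> :: real
  assumes "N \<ge> 1" "0 \<le> \<theta>" "\<theta> < 1"
  defines "y \<equiv> real (N - 1) * \<theta>"
  shows "(1 - \<theta>) ^ N * (1 + real N * (\<theta> / (1 - \<theta>))) \<le> exp (- (y\<^sup>2 / (2 * (1 + y))))"
proof -
  obtain M where N: "N = Suc M" using assms(1) by (cases N) auto
  have y: "y = real M * \<theta>" "y \<ge> 0" using assms by (auto simp: N)
  \<comment> \<open>One factor \<open>1 - \<theta>\<close> clears the denominator, and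
    \<open>1 - \<theta> + (M + 1) * \<theta> = 1 + M * \<theta>\<close>; hence \<open>N - 1\<close>
    rather than \<open>N\<close> in \<open>y\<close>.\<close>
  have "(1 - \<theta>) ^ N * (1 + real N * (\<theta> / (1 - \<theta>))) = (1 + y) * (1 - \<theta>) ^ M"
    using assms by (simp add: N y field_simps)
  also have "\<dots> \<le> (1 + y) * exp (- \<theta>) ^ M"
    using assms y exp_ge_add_one_self[of "- \<theta>"] by (intro mult_left_mono power_mono) auto
  also have "exp (- \<theta>) ^ M = exp (- y)"
    by (simp add: y flip: exp_of_nat_mult)
  finally show ?thesis using one_plus_mult_exp_le[OF y(2)] by simp
qed

text \<open>Markov's inequality: this binomial distribution has mean \<open>r / 2\<close>, so it
  exceeds \<open>r\<close> with probability at most \<open>1 / 2\<close>.\<close>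

lemma sum_Bernstein_ge_half:
  assumes "r \<ge> 1" "r \<le> n"
  shows "(\<Sum>k\<le>r. Bernstein n k (real r / (2 * real n))) \<ge> 1 / 2"
proof -
  define \<theta> where "\<theta> = real r / (2 * real n)"
  have \<theta>: "0 \<le> \<theta>" "\<theta> \<le> 1" using assms by (auto simp: \<theta>_def)
  have split: "(\<Sum>k\<le>n. Bernstein n k \<theta>) = (\<Sum>k\<le>r. Bernstein n k \<theta>) + (\<Sum>k\<in>{r<..n}. Bernstein n k \<theta>)"
  proof -
    have "{..n} = {..r} \<union> {r<..n}" using assms by auto
    then show ?thesis by (simp only:) (rule sum.union_disjoint, auto)
  qed
  have "real r * (\<Sum>k\<in>{r<..n}. Bernstein n k \<theta>) \<le> (\<Sum>k\<in>{r<..n}. real k * Bernstein n k \<theta>)"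
    unfolding sum_distrib_left
    by (intro sum_mono mult_right_mono) (auto simp: Bernstein_nonneg \<theta>)
  also have "\<dots> \<le> (\<Sum>k\<le>n. real k * Bernstein n k \<theta>)"
    by (intro sum_mono2) (auto simp: Bernstein_nonneg \<theta>)
  also have "\<dots> = real r * (1 / 2)"
    using assms by (simp add: \<theta>_def)
  finally have "(\<Sum>k\<in>{r<..n}. Bernstein n k \<theta>) \<le> 1 / 2"
    using assms by (subst (asm) mult_le_cancel_left_pos) auto
  then show ?thesis using split by (simp add: \<theta>_def)
qed

text \<open>Instead of drawing exactly \<open>r\<close> elements, draw every element independently with probability
  \<open>r / (2 * n)\<close>. With probability at least \<open>1 / 2\<close> this yields at most \<open>r\<close> elements, and the
  colour classes become independent.\<close>

lemma rainbow_fraction_le: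
  fixes f :: "'a \<Rightarrow> 'b"
  assumes "finite V" "r \<ge> 1" "r \<le> card V"
  defines "y \<equiv> \<lambda>c. real (card {v\<in>V. f v = c} - 1) * (real r / (2 * real (card V)))"
  shows "real (card (rainbow_sets f V r)) / real (card V choose r)
    \<le> 2 * exp (- (\<Sum>c\<in>f ` V. (y c)\<^sup>2 / (2 * (1 + y c))))"
proof -
  define n where "n = card V"
  define \<theta> where "\<theta> = real r / (2 * real n)"
  \<comment> \<open>\<open>w\<close> is the odds of inclusion, so a set \<open>S\<close> is drawn
    with probability \<open>(1 - \<theta>) ^ n * w ^ card S\<close>.\<close>
  define w where "w = \<theta> / (1 - \<theta>)"
  define q where "q = (\<lambda>k. real (card (rainbow_sets f V k)) / real (n choose k))"
  let ?N = "\<lambda>c. card {v\<in>V. f v = c}"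
  have \<theta>: "0 \<le> \<theta>" "\<theta> \<le> 1 / 2" using assms by (auto simp: \<theta>_def n_def)
  have q0: "q k \<ge> 0" for k by (simp add: q_def)
  \<comment> \<open>The weights for \<open>k \<le> r\<close> have total at least
    \<open>1 / 2\<close>, and \<open>q r \<le> q k\<close> there by monotonicity; this costs the
    factor \<open>2\<close>.\<close>
  have "q r * (1 / 2) \<le> q r * (\<Sum>k\<le>r. Bernstein n k \<theta>)"
    using sum_Bernstein_ge_half[of r n] assms q0 by (intro mult_left_mono) (auto simp: \<theta>_def n_def)
  also have "\<dots> \<le> (\<Sum>k\<le>r. q k * Bernstein n k \<theta>)"
    unfolding sum_distrib_left using assms \<theta>
    by (intro sum_mono mult_right_mono)
      (auto simp: q_def n_def Bernstein_nonneg intro!: rainbow_fraction_antimono)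
  also have "\<dots> \<le> (\<Sum>k\<le>n. q k * Bernstein n k \<theta>)"
    using assms \<theta> q0 by (intro sum_mono2) (auto simp: n_def Bernstein_nonneg)
  also have "\<dots> = (\<Sum>k\<le>n. \<Sum>S | S \<in> {S. S \<subseteq> V \<and> inj_on f S} \<and> card S = k. (1 - \<theta>) ^ n * w ^ card S)"
  proof (rule sum.cong)
    fix k assume k: "k \<in> {..n}"
    have "(1 - \<theta>) ^ n = (1 - \<theta>) ^ k * (1 - \<theta>) ^ (n - k)"
      using k by (simp flip: power_add)
    then have "\<theta> ^ k * (1 - \<theta>) ^ (n - k) = (1 - \<theta>) ^ n * w ^ k"
      using \<theta> by (simp add: w_def power_divide)
    moreover have "{S \<in> {S. S \<subseteq> V \<and> inj_on f S}. card S = k} = rainbow_sets f V k"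
      by (auto simp: rainbow_sets_def)
    moreover have "n choose k \<noteq> 0" using k by simp
    ultimately show "q k * Bernstein n k \<theta> =
        (\<Sum>S | S \<in> {S. S \<subseteq> V \<and> inj_on f S} \<and> card S = k. (1 - \<theta>) ^ n * w ^ card S)"
      by (simp add: q_def Bernstein_def rainbow_sets_def)
  qed simp
  also have "\<dots> = (\<Sum>S | S \<subseteq> V \<and> inj_on f S. (1 - \<theta>) ^ n * w ^ card S)"
    using assms(1) by (intro sum.group) (auto simp: n_def intro: card_mono)
  also have "\<dots> = (1 - \<theta>) ^ n * (\<Prod>c\<in>f ` V. 1 + real (?N c) * w)"
    using assms(1) by (simp add: sum_rainbow_sets[of "f ` V"] flip: sum_distrib_left)
  \<comment> \<open>Splitting \<open>n\<close> into class sizes distributes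
    \<open>(1 - \<theta>) ^ n\<close> over the classes.\<close>
  also have "n = (\<Sum>c\<in>f ` V. ?N c)"
    using assms(1) card_eq_sum[of V] sum.group[of V "f ` V" f "\<lambda>_. 1::nat"]
    by (simp add: n_def)
  also have "(1 - \<theta>) ^ \<dots> = (\<Prod>c\<in>f ` V. (1 - \<theta>) ^ ?N c)"
    by (rule power_sum)
  also have "\<dots> * (\<Prod>c\<in>f ` V. 1 + real (?N c) * w)
      = (\<Prod>c\<in>f ` V. (1 - \<theta>) ^ ?N c * (1 + real (?N c) * w))"
    by (simp add: prod.distrib)
  also have "\<dots> \<le> (\<Prod>c\<in>f ` V. exp (- ((y c)\<^sup>2 / (2 * (1 + y c)))))"
  proof (rule prod_mono)
    fix c assume "c \<in> f ` V"
    then have "card {v\<in>V. f v = c} \<noteq> 0" using assms(1) by auto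
    then have "?N c \<ge> 1" by linarith
    then show "0 \<le> (1 - \<theta>) ^ ?N c * (1 + real (?N c) * w) \<and>
        (1 - \<theta>) ^ ?N c * (1 + real (?N c) * w) \<le> exp (- ((y c)\<^sup>2 / (2 * (1 + y c))))"
      using binomial_at_most_one_le[of "?N c" \<theta>] \<theta> by (auto simp: w_def y_def \<theta>_def n_def)
  qed
  also have "\<dots> = exp (- (\<Sum>c\<in>f ` V. (y c)\<^sup>2 / (2 * (1 + y c))))"
    using assms(1) by (simp add: exp_sum flip: sum_negf)
  finally show ?thesis by (simp add: q_def n_def)
qed

text \<open>Let \<open>R = r * sqrt \<epsilon>\<close>. A class with \<open>y c \<ge> R\<close>
  alone contributes order \<open>R\<close>, as the exponent is linear there. If there is none, every
  denominator is at most \<open>2 * (1 + R)\<close>, and the squares sum to order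
  \<open>R\<^sup>2\<close>.\<close>

lemma rainbow_fraction_le_exp:
  fixes \<epsilon> :: real
  assumes "finite V" "r \<le> card V" "card V \<ge> 2" "0 < \<epsilon>"
    and R: "real r * sqrt \<epsilon> \<ge> 1"
    and pairs: "(\<Sum>c\<in>f ` V. real (card {v\<in>V. f v = c}) * real (card {v\<in>V. f v = c} - 1))
      \<ge> \<epsilon> * real (card V) * real (card V - 1)"
  shows "real (card (rainbow_sets f V r)) / real (card V choose r) \<le> 2 * exp (- (real r * sqrt \<epsilon> / 64))"
proof -
  define n where "n = card V"
  define \<theta> where "\<theta> = real r / (2 * real n)"
  define N where "N = (\<lambda>c. card {v\<in>V. f v = c})"
  define y where "y = (\<lambda>c. real (N c - 1) * \<theta>)"
  define R where "R = real r * sqrt \<epsilon>"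
  have r: "r \<ge> 1" using R by (cases r) auto
  have n: "n \<ge> 2" using assms by (simp add: n_def)
  have y0: "y c \<ge> 0" for c by (simp add: y_def \<theta>_def)
  have R1: "R \<ge> 1" using assms by (simp add: R_def)
  have "R / 64 \<le> (\<Sum>c\<in>f ` V. (y c)\<^sup>2 / (2 * (1 + y c)))"
  proof (cases "\<exists>c\<in>f ` V. y c \<ge> R")
    case True
    then obtain c where c: "c \<in> f ` V" "y c \<ge> R" by blast
    have "R / 64 \<le> y c / 4" using c R1 by simp
    also have "y c / 4 \<le> (y c)\<^sup>2 / (2 * (1 + y c))"
    proof -
      have "y c \<ge> 1" using c R1 by simp
      then have "y c * (1 + y c) \<le> y c * (2 * y c)" by (intro mult_left_mono) auto
      then show ?thesis using y0[of c] by (simp add: field_simps power2_eq_square)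
    qed
    also have "\<dots> \<le> (\<Sum>c\<in>f ` V. (y c)\<^sup>2 / (2 * (1 + y c)))"
      using assms(1) c y0 by (intro member_le_sum) (auto simp: add_nonneg_nonneg)
    finally show ?thesis .
  next
    case False
    have "\<epsilon> * real n * real (n - 1) \<le> (\<Sum>c\<in>f ` V. real (N c) * real (N c - 1))"
      using pairs by (simp add: n_def N_def)
    also have "\<dots> \<le> (\<Sum>c\<in>f ` V. 2 * (real (N c - 1))\<^sup>2)"
    proof (rule sum_mono)
      fix c
      show "real (N c) * real (N c - 1) \<le> 2 * (real (N c - 1))\<^sup>2"
      proof (cases "N c \<le> 1")
        case False
        then have "real (N c) * real (N c - 1) \<le> (2 * real (N c - 1)) * real (N c - 1)"
          by (intro mult_right_mono) auto
        then show ?thesis by (simp add: power2_eq_square)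
      qed simp
    qed
    finally have "\<epsilon> * real n * real (n - 1) \<le> (\<Sum>c\<in>f ` V. 2 * (real (N c - 1))\<^sup>2)" .
    moreover have "\<epsilon> * real n * (real n / 2) \<le> \<epsilon> * real n * real (n - 1)"
      using n assms by (intro mult_left_mono) auto
    ultimately have "\<epsilon> * (real n)\<^sup>2 / 4 \<le> (\<Sum>c\<in>f ` V. (real (N c - 1))\<^sup>2)"
      by (simp add: power2_eq_square flip: sum_distrib_left)
    then have "\<epsilon> * (real n)\<^sup>2 / 4 * \<theta>\<^sup>2 \<le> (\<Sum>c\<in>f ` V. (real (N c - 1))\<^sup>2) * \<theta>\<^sup>2"
      by (rule mult_right_mono) simp
    also have "\<dots> = (\<Sum>c\<in>f ` V. (y c)\<^sup>2)"
      by (simp add: y_def sum_distrib_right power_mult_distrib)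
    also have "\<epsilon> * (real n)\<^sup>2 / 4 * \<theta>\<^sup>2 = R\<^sup>2 / 16"
      using n assms by (simp add: \<theta>_def R_def power_divide power_mult_distrib)
    \<comment> \<open>As \<open>R \<ge> 1\<close>, the denominator \<open>2 * (1 + R)\<close> is at
      most \<open>4 * R\<close>, and \<open>R\<^sup>2 / 16\<close> over \<open>4 * R\<close> is
      \<open>R / 64\<close>.\<close>
    finally have "R\<^sup>2 / 16 * (1 / (2 * (1 + R))) \<le> (\<Sum>c\<in>f ` V. (y c)\<^sup>2) * (1 / (2 * (1 + R)))"
      using R1 by (intro mult_right_mono) auto
    moreover have "R / 64 \<le> R\<^sup>2 / 16 * (1 / (2 * (1 + R)))"
    proof -
      have "R * (1 + R) \<le> R * (2 * R)" using R1 by (intro mult_left_mono) auto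
      then show ?thesis using R1 by (simp add: field_simps power2_eq_square)
    qed
    moreover have "(\<Sum>c\<in>f ` V. (y c)\<^sup>2) * (1 / (2 * (1 + R))) \<le> (\<Sum>c\<in>f ` V. (y c)\<^sup>2 / (2 * (1 + y c)))"
      unfolding sum_distrib_right
    proof (rule sum_mono)
      fix c assume "c \<in> f ` V"
      then have "y c \<le> R" using False by force
      then show "(y c)\<^sup>2 * (1 / (2 * (1 + R))) \<le> (y c)\<^sup>2 / (2 * (1 + y c))"
        using y0[of c] R1 by (simp add: frac_le)
    qed
    ultimately show ?thesis by linarith
  qed
  then have "2 * exp (- (\<Sum>c\<in>f ` V. (y c)\<^sup>2 / (2 * (1 + y c)))) \<le> 2 * exp (- (R / 64))"
    by simp
  with rainbow_fraction_le[OF assms(1) r assms(2), of f] show ?thesis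
    unfolding y_def N_def \<theta>_def n_def R_def by (rule order_trans)
qed

section \<open>Counting unseparated pairs\<close>

lemma card_symmetric_pairs:
  fixes V :: "nat set"
  assumes "finite V" "\<And>i. i \<in> V \<Longrightarrow> Q i i" "\<And>i j. Q i j \<Longrightarrow> Q j i"
  shows "card {(i, j) \<in> V \<times> V. Q i j} = card V + 2 * card {(i, j) \<in> V \<times> V. i < j \<and> Q i j}"
proof -
  let ?L = "{(i, j) \<in> V \<times> V. i < j \<and> Q i j}"
  have fin: "finite ?L"
    by (rule finite_subset[of _ "V \<times> V"]) (use assms(1) in auto)
  have "{(i, j) \<in> V \<times> V. Q i j} = (\<lambda>i. (i, i)) ` V \<union> (?L \<union> prod.swap ` ?L)"
  proof (intro equalityI subsetI)
    fix p assume "p \<in> {(i, j) \<in> V \<times> V. Q i j}"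
    then obtain i j where p: "p = (i, j)" "i \<in> V" "j \<in> V" "Q i j" by auto
    consider "i = j" | "i < j" | "j < i" by linarith
    then show "p \<in> (\<lambda>i. (i, i)) ` V \<union> (?L \<union> prod.swap ` ?L)"
    proof cases
      case 3
      then have "p \<in> prod.swap ` ?L"
        using p assms(3) by (intro image_eqI[of _ _ "(j, i)"]) auto
      then show ?thesis by blast
    qed (use p in auto)
  qed (use assms in auto)
  also have "card \<dots> = card ((\<lambda>i. (i, i)) ` V) + card (?L \<union> prod.swap ` ?L)"
    using assms(1) fin by (intro card_Un_disjoint) auto
  also have "card (?L \<union> prod.swap ` ?L) = card ?L + card (prod.swap ` ?L)"
    using fin by (intro card_Un_disjoint) auto
  also have "card (prod.swap ` ?L) = card ?L"
    by (intro card_image) (auto simp: inj_on_def)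
  also have "card ((\<lambda>i. (i, i)) ` V) = card V"
    by (intro card_image) (auto simp: inj_on_def)
  finally show ?thesis by simp
qed

text \<open>Twice the unseparated pairs plus the \<open>n\<close> diagonal pairs are all ordered
  unseparated pairs. This form suits class sizes, whose squares sum to that number.\<close>

lemma is_bad_iff:
  "is_bad \<epsilon> n x A \<longleftrightarrow>
    \<epsilon> * real n * (real n - 1) + real n
      < real (card {(i, j) \<in> {1..n} \<times> {1..n}. \<not> separates A (x i) (x j)})"
proof -
  let ?V = "{1..n}"
  let ?L = "\<lambda>Q. {(i, j) \<in> ?V \<times> ?V. i < j \<and> Q i j}"
  let ?sep = "\<lambda>i j. separates A (x i) (x j)"
  have fin: "finite (?L Q)" for Q
    by (rule finite_subset[of _ "?V \<times> ?V"]) auto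
  have "?L (\<lambda>_ _. True) = ?L ?sep \<union> ?L (\<lambda>i j. \<not> ?sep i j)" by auto
  then have split: "card (?L (\<lambda>_ _. True)) = card (?L ?sep) + card (?L (\<lambda>i j. \<not> ?sep i j))"
    using card_Un_disjoint[OF fin fin, of ?sep "\<lambda>i j. \<not> ?sep i j"] by fastforce
  have all: "n * n = n + 2 * card (?L (\<lambda>_ _. True))"
  proof -
    have "{(i, j) \<in> ?V \<times> ?V. True} = ?V \<times> ?V" by auto
    then have "card {(i, j) \<in> ?V \<times> ?V. True} = n * n" by (simp only:) (simp add: card_cartesian_product)
    then show ?thesis using card_symmetric_pairs[of ?V "\<lambda>_ _. True"] by simp
  qed
  have unsep: "card {(i, j) \<in> ?V \<times> ?V. \<not> ?sep i j} = n + 2 * card (?L (\<lambda>i j. \<not> ?sep i j))"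
  proof -
    have "\<not> ?sep i i" "\<not> ?sep i j \<Longrightarrow> \<not> ?sep j i" for i j
      by (auto simp: separates_def)
    then show ?thesis using card_symmetric_pairs[of ?V "\<lambda>i j. \<not> ?sep i j"] by simp
  qed
  have "2 * (n choose 2) = n * (n - 1)"
  proof -
    have "even (n * (n - 1))" by (cases n) auto
    then show ?thesis by (simp add: choose_two)
  qed
  then have "real (2 * (n choose 2)) = real (n * (n - 1))" by (rule arg_cong)
  then have choose: "2 * real (n choose 2) = real n * (real n - 1)"
    by (cases n) (simp_all add: algebra_simps)
  have "{(i, j). 1 \<le> i \<and> i < j \<and> j \<le> n \<and> ?sep i j} = ?L ?sep" by auto
  then have "is_bad \<epsilon> n x A \<longleftrightarrow> 2 * real (card (?L ?sep)) < (1 - \<epsilon>) * (2 * real (n choose 2))"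
    by (simp add: is_bad_def)
  also have "2 * real (card (?L ?sep))
      = real n * (real n - 1) - (real (card {(i, j) \<in> ?V \<times> ?V. \<not> ?sep i j}) - real n)"
  proof -
    have "real (n * n) = real (n + 2 * card (?L (\<lambda>_ _. True)))" using all by simp
    then show ?thesis unfolding split unsep by (simp add: algebra_simps)
  qed
  finally show ?thesis unfolding choose by (simp add: algebra_simps)
qed

section \<open>The distribution of the sample\<close>

lemma finite_index_samples: "finite (index_samples n r)"
  unfolding index_samples_def
  by (rule finite_subset[OF _ finite_lists_length_eq[of "{1..n}" r]]) auto

lemma index_samples_nonempty: "r \<le> n \<Longrightarrow> index_samples n r \<noteq> {}"
  by (auto simp: index_samples_def intro!: exI[of _ "[1..<Suc r]"])

lemma prob_answers_pmf:
  assumes "r \<le> n"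
  shows "measure_pmf.prob (answers_pmf alg n r x) E =
    (\<Sum>js\<in>index_samples n r. measure_pmf.prob (alg (map x js)) E) / real (card (index_samples n r))"
proof -
  have "measure_pmf.prob (answers_pmf alg n r x) E =
      measure_pmf.expectation (pmf_of_set (index_samples n r)) (\<lambda>js. measure_pmf.prob (alg (map x js)) E)"
    unfolding answers_pmf_def measure_pmf_bind
    by (rule measure_pmf.measure_bind[where N = "count_space UNIV"]) (auto simp: measure_subprob)
  also have "\<dots> = (\<Sum>js\<in>index_samples n r. measure_pmf.prob (alg (map x js)) E) / real (card (index_samples n r))"
    using assms by (intro integral_pmf_of_set index_samples_nonempty finite_index_samples)
  finally show ?thesis .
qed

section \<open>Hiding a large clique from the sample\<close>

text \<open>The ratio is the probability that a random set of \<open>s\<close> among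
  \<open>n\<close> indices avoids \<open>r\<close> given ones. It is a product of \<open>s\<close>
  factors \<open>1 - r / (n - i)\<close>, and \<open>i < s\<close> bounds each from below.\<close>

lemma binomial_ratio_ge:
  assumes "r + s \<le> n" "s < n"
  shows "(1 - real r / real (n - s)) ^ s \<le> real (n - r choose s) / real (n choose s)"
proof -
  have "real (n - r choose s) / real (n choose s) =
      (\<Prod>i = 0..<s. real (n - r - i) / real (s - i)) / (\<Prod>i = 0..<s. real (n - i) / real (s - i))"
    using assms by (simp add: binomial_altdef_of_nat)
  also have "\<dots> = (\<Prod>i = 0..<s. real (n - r - i) / real (n - i))"
    by (subst prod_dividef[symmetric], rule prod.cong) auto
  also have "\<dots> \<ge> (\<Prod>i = 0..<s. 1 - real r / real (n - s))"
  proof (rule prod_mono, safe)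
    fix i assume i: "i \<in> {0..<s}"
    show "0 \<le> 1 - real r / real (n - s)" using assms by (simp add: field_simps)
    have "real (n - r - i) / real (n - i) = 1 - real r / real (n - i)"
      using assms i by (simp add: field_simps of_nat_diff)
    moreover have "real r / real (n - i) \<le> real r / real (n - s)"
      using assms i by (intro divide_left_mono) auto
    ultimately show "1 - real r / real (n - s) \<le> real (n - r - i) / real (n - i)" by linarith
  qed
  finally show ?thesis by simp
qed

text \<open>In the data set below, coordinate \<open>a\<close> is a key unless \<open>a \<in> B\<close>; in that case the tuples with
  indices in \<open>T a\<close> agree on \<open>a\<close>, and \<open>a\<close> is bad. A sample that avoids \<open>T a\<close> carries no information
  on whether \<open>a \<in> B\<close>.\<close>

definition planted_data :: "(nat \<Rightarrow> 'u) \<Rightarrow> nat \<Rightarrow> nat \<Rightarrow> nat set \<Rightarrow> (nat \<Rightarrow> nat set) \<Rightarrow> nat \<Rightarrow> 'u tuple" where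
  "planted_data u m n B T =
    (\<lambda>i\<in>{1..n}. \<lambda>a\<in>{1..m}. if a \<in> B \<and> i \<in> T a then u 1 else u i)"

lemma planted_data_in_data_sets:
  assumes "u ` {1..n} \<subseteq> U"
  shows "planted_data u m n B T \<in> data_sets U m n"
  using assms by (auto simp: planted_data_def data_sets_def image_subset_iff)

lemma planted_data_key:
  assumes "inj_on u {1..n}" "a \<in> {1..m}" "a \<notin> B"
  shows "is_key n (planted_data u m n B T) {a}"
  unfolding is_key_def
proof (intro ballI impI)
  fix i j assume ij: "i \<in> {1..n}" "j \<in> {1..n}" "i < j"
  then have "u i \<noteq> u j" using inj_onD[OF assms(1)] by blast
  then show "separates {a} (planted_data u m n B T i) (planted_data u m n B T j)"
    using ij assms by (simp add: separates_def planted_data_def)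
qed

lemma planted_data_bad:
  assumes "a \<in> {1..m}" "a \<in> B" "T a \<subseteq> {1..n}"
    and "\<epsilon> * real n * (real n - 1) < real (card (T a)) * (real (card (T a)) - 1)"
  shows "is_bad \<epsilon> n (planted_data u m n B T) {a}"
proof -
  let ?V = "{1..n}" and ?x = "planted_data u m n B T"
  let ?P = "{(i, j) \<in> ?V \<times> ?V. \<not> separates {a} (?x i) (?x j)}"
  let ?D = "(\<lambda>i. (i, i)) ` (?V - T a)"
  have finT: "finite (T a)" using assms(3) finite_subset by blast
  have "card (T a \<times> T a \<union> ?D) = card (T a \<times> T a) + card ?D"
    using finT by (intro card_Un_disjoint) auto
  also have "card ?D = n - card (T a)"
    using finT assms(3) by (subst card_image) (auto simp: inj_on_def card_Diff_subset)
  finally have card: "card (T a \<times> T a \<union> ?D) = card (T a) * card (T a) + (n - card (T a))"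
    by (simp add: card_cartesian_product)
  \<comment> \<open>Only an inequality: tuple \<open>1\<close> carries the value \<open>u 1\<close>
    at \<open>a\<close> even if \<open>1\<close> is not in \<open>T a\<close>, so further pairs may
    be unseparated.\<close>
  have "card (T a \<times> T a \<union> ?D) \<le> card ?P"
  proof (rule card_mono)
    show "finite ?P" by (rule finite_subset[of _ "?V \<times> ?V"]) auto
    show "T a \<times> T a \<union> ?D \<subseteq> ?P"
      using assms by (auto simp: separates_def planted_data_def)
  qed
  then have "real (card (T a) * card (T a) + (n - card (T a))) \<le> real (card ?P)"
    unfolding card by (simp only: of_nat_le_iff)
  moreover have "card (T a) \<le> n"
    using card_mono[of ?V "T a"] assms(3) by simp
  ultimately show ?thesis
    unfolding is_bad_iff using assms(4) by (simp add: of_nat_diff algebra_simps)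
qed

text \<open>At a coordinate where \<open>B\<close> and \<open>B'\<close> differ, the sampled indices
  lie outside \<open>T a\<close> and receive \<open>u j\<close> either way; in this sense the sample
  hides the coin.\<close>

lemma map_planted_data_cong:
  assumes "set js \<subseteq> {1..n}" "\<And>a. a \<in> B \<union> B' \<Longrightarrow> a \<in> {1..m} \<Longrightarrow> a \<notin> B \<inter> B' \<Longrightarrow> T a \<inter> set js = {}"
  shows "map (planted_data u m n B T) js = map (planted_data u m n B' T) js"
proof (rule map_cong[OF refl])
  fix j assume "j \<in> set js"
  then show "planted_data u m n B T j = planted_data u m n B' T j"
    using assms by (auto simp: planted_data_def fun_eq_iff restrict_def)
qed

text \<open>Testing singletons suffices for the lower bounds. For different subsets \<open>B\<close>
  of \<open>{1..m}\<close> these events are disjoint.\<close>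

definition answers_for :: "nat \<Rightarrow> nat set \<Rightarrow> (nat set \<Rightarrow> bool) set" where
  "answers_for m B = {ans. \<forall>a\<in>{1..m}. ans {a} \<longleftrightarrow> a \<notin> B}"

text \<open>Let \<open>H\<close> be the coordinates hidden from the sample. Sets \<open>B\<close>
  that agree outside \<open>H\<close> give the same sampled tuples, so their disjoint success events
  share one distribution and sum to at most \<open>1\<close>; there are
  \<open>2 ^ (m - card H)\<close> such groups.\<close>

lemma sum_prob_answers_le:
  fixes alg :: "'u filter_alg"
  assumes js: "set js \<subseteq> {1..n}"
  shows "(\<Sum>B\<in>Pow {1..m}. measure_pmf.prob (alg (map (planted_data u m n B T) js)) (answers_for m B))
    \<le> 2 ^ m * (\<Prod>a\<in>{1..m}. if T a \<inter> set js = {} then 1 / 2 else 1)"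
proof -
  define H where "H = {a\<in>{1..m}. T a \<inter> set js = {}}"
  define p where "p = (\<lambda>B. measure_pmf.prob (alg (map (planted_data u m n B T) js)) (answers_for m B))"
  have H: "H \<subseteq> {1..m}" "finite H" by (auto simp: H_def)
  have "(\<Sum>B\<in>Pow {1..m}. p B) = (\<Sum>B'\<in>Pow ({1..m} - H). \<Sum>B | B \<in> Pow {1..m} \<and> B - H = B'. p B)"
    by (rule sum.group[symmetric]) auto
  also have "\<dots> \<le> (\<Sum>B'\<in>Pow ({1..m} - H). 1)"
  proof (rule sum_mono)
    fix B' assume "B' \<in> Pow ({1..m} - H)"
    let ?F = "{B. B \<in> Pow {1..m} \<and> B - H = B'}"
    let ?M = "measure_pmf (alg (map (planted_data u m n B' T) js))"
    have fin: "finite ?F" by (rule finite_subset[of _ "Pow {1..m}"]) auto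
    have "(\<Sum>B\<in>?F. p B) = (\<Sum>B\<in>?F. measure ?M (answers_for m B))"
    proof (rule sum.cong)
      fix B assume "B \<in> ?F"
      then have "map (planted_data u m n B T) js = map (planted_data u m n B' T) js"
        using js by (intro map_planted_data_cong) (auto simp: H_def)
      then show "p B = measure ?M (answers_for m B)" by (simp only: p_def)
    qed simp
    also have "\<dots> = measure ?M (\<Union>B\<in>?F. answers_for m B)"
    proof (rule measure_pmf.finite_measure_finite_Union[symmetric, OF fin])
      show "disjoint_family_on (answers_for m) ?F"
        unfolding disjoint_family_on_def
      proof (intro ballI impI)
        fix B1 B2 assume "B1 \<in> ?F" "B2 \<in> ?F" "B1 \<noteq> B2"
        then obtain a where a: "a \<in> B1 \<longleftrightarrow> a \<notin> B2" by blast
        moreover have "B1 \<subseteq> {1..m}" "B2 \<subseteq> {1..m}" using \<open>B1 \<in> ?F\<close> \<open>B2 \<in> ?F\<close> by auto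
        ultimately have "a \<in> {1..m}" by blast
        with a show "answers_for m B1 \<inter> answers_for m B2 = {}"
          by (auto simp: answers_for_def)
      qed
    qed simp
    also have "\<dots> \<le> 1" by simp
    finally show "(\<Sum>B\<in>?F. p B) \<le> 1" .
  qed
  also have "\<dots> = 2 ^ (m - card H)"
    using H by (simp add: card_Pow card_Diff_subset)
  also have "\<dots> = 2 ^ m * (1 / 2) ^ card H"
    using card_mono[OF _ H(1)] by (simp add: power_diff power_divide)
  also have "(1 / 2) ^ card H = (\<Prod>a\<in>{1..m}. if T a \<inter> set js = {} then 1 / 2 else (1::real))"
    by (simp add: prod.If_cases H_def Int_def)
  finally show ?thesis by (simp add: p_def)
qed

text \<open>Averaging over all \<open>B\<close> and over all families \<open>T\<close> of \<open>s\<close>-sets: the sample avoids each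
  \<open>T a\<close> independently, and each time this happens the filter has to guess.\<close>

lemma solves_key_filter_imp_le:
  fixes alg :: "'u filter_alg"
  assumes solves: "solves_key_filter alg r U m n \<epsilon> \<delta>"
    and U: "u ` {1..n} \<subseteq> U" "inj_on u {1..n}"
    and "r \<le> n" "s \<le> n"
    and s: "\<epsilon> * real n * (real n - 1) < real s * (real s - 1)"
  shows "1 - \<delta> \<le> (1 - real (n - r choose s) / real (n choose s) / 2) ^ m"
proof -
  define C where "C = {S. S \<subseteq> {1..n} \<and> card S = s}"
  define TT where "TT = {1..m} \<rightarrow>\<^sub>E C"
  define J where "J = index_samples n r"
  define N where "N = real (n choose s)"
  define p where "p = real (n - r choose s) / N"
  define P where "P = (\<lambda>T B js. measure_pmf.prob (alg (map (planted_data u m n B T) js)) (answers_for m B))"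
  have C: "finite C" "card C = n choose s"
    unfolding C_def using n_subsets[of "{1..n}" s] by auto
  have N: "N > 0" using assms by (simp add: N_def)
  have TT: "finite TT" "card TT = (n choose s) ^ m"
    using C by (auto simp: TT_def card_PiE intro: finite_PiE)
  have J: "finite J" "card J > 0"
    using finite_index_samples index_samples_nonempty[OF \<open>r \<le> n\<close>] by (auto simp: J_def card_gt_0_iff)
  have each: "(1 - \<delta>) * real (card J) \<le> (\<Sum>js\<in>J. P T B js)" if T: "T \<in> TT" and B: "B \<in> Pow {1..m}" for T B
  proof -
    let ?x = "planted_data u m n B T"
    have sub: "ans \<in> answers_for m B" if ans: "\<forall>A\<subseteq>{1..m}. correct_answer \<epsilon> n ?x A (ans A)" for ans
      unfolding answers_for_def
    proof (intro CollectI ballI)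
      fix a assume a: "a \<in> {1..m}"
      then have "T a \<in> C" using T by (auto simp: TT_def)
      then have "a \<in> B \<Longrightarrow> is_bad \<epsilon> n ?x {a}" "a \<notin> B \<Longrightarrow> is_key n ?x {a}"
        using a s U by (auto simp: C_def intro!: planted_data_bad planted_data_key)
      moreover have "correct_answer \<epsilon> n ?x {a} (ans {a})" using ans a by auto
      ultimately show "ans {a} \<longleftrightarrow> a \<notin> B" by (auto simp: correct_answer_def)
    qed
    have "1 - \<delta> \<le> measure_pmf.prob (answers_pmf alg n r ?x)
        {ans. \<forall>A\<subseteq>{1..m}. correct_answer \<epsilon> n ?x A (ans A)}"
      using solves planted_data_in_data_sets[OF U(1)] by (auto simp: solves_key_filter_def)
    also have "\<dots> \<le> measure_pmf.prob (answers_pmf alg n r ?x) (answers_for m B)"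
      using sub by (intro measure_pmf.finite_measure_mono) auto
    also have "\<dots> = (\<Sum>js\<in>J. P T B js) / real (card J)"
      unfolding prob_answers_pmf[OF \<open>r \<le> n\<close>] by (simp add: P_def J_def)
    finally show ?thesis using J by (simp only: pos_le_divide_eq of_nat_0_less_iff)
  qed
  have "(1 - \<delta>) * real (card J) * (N ^ m * 2 ^ m) = (\<Sum>T\<in>TT. \<Sum>B\<in>Pow {1..m}. (1 - \<delta>) * real (card J))"
    using TT by (simp add: card_Pow N_def)
  also have "\<dots> \<le> (\<Sum>T\<in>TT. \<Sum>B\<in>Pow {1..m}. \<Sum>js\<in>J. P T B js)"
    by (intro sum_mono each)
  also have "\<dots> = (\<Sum>T\<in>TT. \<Sum>js\<in>J. \<Sum>B\<in>Pow {1..m}. P T B js)"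
    by (intro sum.cong refl sum.swap)
  also have "\<dots> = (\<Sum>js\<in>J. \<Sum>T\<in>TT. \<Sum>B\<in>Pow {1..m}. P T B js)"
    by (rule sum.swap)
  also have "\<dots> \<le> (\<Sum>js\<in>J. 2 ^ m * (N * (1 - p / 2)) ^ m)"
  proof (rule sum_mono)
    fix js assume js: "js \<in> J"
    then have js': "set js \<subseteq> {1..n}" "card (set js) = r"
      by (auto simp: J_def index_samples_def distinct_card)
    let ?g = "\<lambda>S. if S \<inter> set js = {} then 1 / 2 else (1::real)"
    have "(\<Sum>T\<in>TT. \<Sum>B\<in>Pow {1..m}. P T B js) \<le> (\<Sum>T\<in>TT. 2 ^ m * (\<Prod>a\<in>{1..m}. ?g (T a)))"
      unfolding P_def using js' by (intro sum_mono sum_prob_answers_le)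
    \<comment> \<open>\<open>T\<close> ranges over all families, so the sum of products factorises:
      the sets \<open>T a\<close> are independent.\<close>
    also have "\<dots> = 2 ^ m * (\<Prod>a\<in>{1..m}. \<Sum>S\<in>C. ?g S)"
      unfolding TT_def using C by (subst prod_sum_PiE) (auto simp: sum_distrib_left)
    also have "(\<Sum>S\<in>C. ?g S) = N * (1 - p / 2)"
    proof -
      have eq: "{S\<in>C. S \<inter> set js = {}} = {S. S \<subseteq> {1..n} - set js \<and> card S = s}"
        by (auto simp: C_def)
      have "card {S\<in>C. S \<inter> set js = {}} = (n - r choose s)"
        unfolding eq using js' by (subst n_subsets) (auto simp: card_Diff_subset)
      then have "real (card {S\<in>C. S \<inter> set js = {}}) = N * p" using N by (simp add: p_def)
      moreover have "(\<Sum>S\<in>C. ?g S) = (\<Sum>S\<in>C. 1 - (if S \<inter> set js = {} then 1 / 2 else 0))"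
        by (rule sum.cong) auto
      moreover have "\<dots> = real (card C) - real (card {S\<in>C. S \<inter> set js = {}}) / 2"
        using C by (simp add: sum_subtractf sum.If_cases Int_def)
      ultimately show ?thesis using C by (simp add: N_def algebra_simps)
    qed
    finally show "(\<Sum>T\<in>TT. \<Sum>B\<in>Pow {1..m}. P T B js) \<le> 2 ^ m * (N * (1 - p / 2)) ^ m" by simp
  qed
  also have "\<dots> = (1 - p / 2) ^ m * real (card J) * (N ^ m * 2 ^ m)"
    by (simp add: power_mult_distrib)
  finally show ?thesis
    using J N by (simp add: p_def N_def mult_le_cancel_right)
qed

text \<open>A coordinate that is a key on its own shows \<open>n\<close> distinct values; the size
  condition on \<open>U\<close> provides them.\<close>

lemma obtain_distinct_values:
  assumes "infinite U \<or> n \<le> card U"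
  obtains u :: "nat \<Rightarrow> 'u" where "u ` {1..n} \<subseteq> U" "inj_on u {1..n}"
proof -
  obtain W where W: "W \<subseteq> U" "finite W" "card W = n"
  proof (cases "infinite U")
    case True
    then show ?thesis using that infinite_arbitrarily_large[of U n] by blast
  next
    case False
    then show ?thesis using that assms obtain_subset_with_card_n[of n U] by (metis finite_subset)
  qed
  then obtain u where "bij_betw u {1..n} W"
    by (metis card_atLeastAtMost diff_Suc_1 finite_atLeastAtMost finite_same_card_bij)
  then show ?thesis using that W by (auto simp: bij_betw_def)
qed

text \<open>The margin \<open>\<gamma>\<close> leaves at least \<open>\<gamma> * n / 2\<close>
  indices outside a planted set, so \<open>t = r / (n - s)\<close> is at most \<open>1 / 2\<close>,
  and \<open>1 - t \<ge> exp (- 2 * t)\<close> turns the avoidance probability into an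
  exponential.\<close>

lemma solves_key_filter_exp_le:
  fixes alg :: "'u filter_alg" and \<epsilon> \<gamma> :: real
  assumes solves: "solves_key_filter alg r U m n \<epsilon> \<delta>"
    and U: "infinite U \<or> n \<le> card U"
    and eps: "0 < \<epsilon>" "sqrt \<epsilon> \<le> 1 - \<gamma>" "2 \<le> sqrt \<epsilon> * real n"
    and \<gamma>: "0 < \<gamma>" "8 \<le> \<gamma> * real n"
    and r: "real r \<le> \<gamma> * real n / 4"
  shows "1 - \<delta> \<le> (1 - exp (- (8 * real r * sqrt \<epsilon> / \<gamma>)) / 2) ^ m"
proof -
  define e where "e = sqrt \<epsilon>"
  have e: "0 < e" "e \<le> 1 - \<gamma>" "\<epsilon> = e * e" "2 \<le> e * real n" using eps by (auto simp: e_def)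
  \<comment> \<open>The extra \<open>1\<close> makes \<open>s - 1\<close> at least
    \<open>e * n\<close> and \<open>s\<close> strictly larger, so that the planted coordinates are
    bad.\<close>
  define s where "s = nat \<lceil>e * real n\<rceil> + 1"
  have s: "e * real n + 1 \<le> real s" "real s \<le> e * real n + 2"
    using e by (auto simp: s_def) linarith+
  have n: "real n > 0" using \<gamma> by (auto intro: ccontr)
  have en: "e * real n \<le> real n - \<gamma> * real n"
    using mult_right_mono[OF e(2), of "real n"] by (simp add: algebra_simps)
  have gap: "real s + \<gamma> * real n / 2 \<le> real n" using s en \<gamma> by linarith
  then have "s < n" using \<gamma> by linarith
  with gap have sn: "s < n" "real (n - s) \<ge> \<gamma> * real n / 2"
    by (auto simp: of_nat_diff)
  have rn: "real r \<le> real (n - s) / 2" using r sn by simp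
  then have "r \<le> n - s" by linarith
  then have rs: "r + s \<le> n" using sn by simp
  obtain u where u: "u ` {1..n} \<subseteq> U" "inj_on u {1..n}"
    using obtain_distinct_values[OF U] by blast
  have "1 - \<delta> \<le> (1 - real (n - r choose s) / real (n choose s) / 2) ^ m"
  proof (rule solves_key_filter_imp_le[OF solves])
    show "u ` {1..n} \<subseteq> U" "inj_on u {1..n}" by (fact u)+
    show "r \<le> n" "s \<le> n" using rs by auto
    have "\<epsilon> * real n * (real n - 1) \<le> \<epsilon> * real n * real n"
      using eps by (intro mult_left_mono) auto
    also have "\<dots> = (e * real n) * (e * real n)" by (simp add: e)
    also have "\<dots> < real s * (e * real n)"
      using s e by (intro mult_strict_right_mono) auto
    also have "\<dots> \<le> real s * (real s - 1)"
      using s by (intro mult_left_mono) auto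
    finally show "\<epsilon> * real n * (real n - 1) < real s * (real s - 1)" .
  qed
  also have "\<dots> \<le> (1 - exp (- (8 * real r * e / \<gamma>)) / 2) ^ m"
  proof (rule power_mono)
    define t where "t = real r / real (n - s)"
    have t: "0 \<le> t" "t \<le> 1 / 2" using rn sn by (auto simp: t_def field_simps)
    have "t \<le> real r / (\<gamma> * real n / 2)"
      unfolding t_def using sn \<gamma> n by (intro divide_left_mono) auto
    \<comment> \<open>\<open>2 \<le> e * n\<close> gives \<open>s \<le> 2 * e * n\<close>; with
      \<open>t \<le> 2 * r / (\<gamma> * n)\<close> this yields the constant
      \<open>8\<close>.\<close>
    then have "2 * real s * t \<le> 2 * (2 * (e * real n)) * (real r / (\<gamma> * real n / 2))"
      using s e t by (intro mult_mono) auto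
    also have "\<dots> = 8 * real r * e / \<gamma>" using n \<gamma> by simp
    finally have "exp (- (8 * real r * e / \<gamma>)) \<le> exp (- (2 * real s * t))" by simp
    also have "\<dots> = exp (- 2 * t) ^ s" by (simp flip: exp_of_nat_mult)
    also have "\<dots> \<le> (1 - t) ^ s"
    proof (rule power_mono)
      have "exp (- 2 * t) = 1 / exp (2 * t)" by (simp add: exp_minus divide_inverse)
      also have "\<dots> \<le> 1 / (1 + 2 * t)"
        using t by (intro divide_left_mono) auto
      also have "\<dots> \<le> 1 - t"
      proof -
        have "t * (2 * t) \<le> t * 1" using t by (intro mult_left_mono) auto
        then show ?thesis using t by (simp add: field_simps)
      qed
      finally show "exp (- 2 * t) \<le> 1 - t" .
    qed simp
    also have "\<dots> \<le> real (n - r choose s) / real (n choose s)"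
      unfolding t_def by (rule binomial_ratio_ge[OF rs sn(1)])
    finally show "1 - real (n - r choose s) / real (n choose s) / 2 \<le> 1 - exp (- (8 * real r * e / \<gamma>)) / 2"
      by simp
    have "(n - r choose s) \<le> (n choose s)" by (rule binomial_right_mono) simp
    then have "real (n - r choose s) / real (n choose s) \<le> 1" by (simp add: divide_le_eq)
    moreover have "0 \<le> 1 - q / 2" if "q \<le> 1" for q :: real using that by simp
    ultimately show "0 \<le> 1 - real (n - r choose s) / real (n choose s) / 2" by blast
  qed
  finally show ?thesis by (simp add: e_def)
qed

section \<open>Sufficiency\<close>

text \<open>Indices are coloured by their projection to \<open>A\<close>. The query accepts exactly
  the rainbow samples, and the squared class sizes sum to the number of ordered unseparated pairs;
  removing the diagonal turns badness into the pair hypothesis of the birthday bound.\<close>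

lemma card_rainbow_samples_le:
  fixes \<epsilon> :: real
  assumes "r \<le> n" "2 \<le> n" "0 < \<epsilon>" "1 \<le> real r * sqrt \<epsilon>" and bad: "is_bad \<epsilon> n x A" and "finite A"
  shows "real (card {js \<in> index_samples n r. key_query (sorted_list_of_set A) (map x js)})
    \<le> 2 * exp (- (real r * sqrt \<epsilon> / 64)) * real (card (index_samples n r))"
proof -
  define V where "V = {1..n}"
  define f where "f = (\<lambda>j. map (x j) (sorted_list_of_set A))"
  define N where "N = (\<lambda>c. card {j\<in>V. f j = c})"
  have V: "finite V" "card V = n" by (auto simp: V_def)
  have sep: "\<not> separates A (x i) (x j) \<longleftrightarrow> f j = f i" for i j
    using \<open>finite A\<close> by (auto simp: separates_def f_def)
  have "{(i, j) \<in> {1..n} \<times> {1..n}. \<not> separates A (x i) (x j)} = (SIGMA i:V. {j\<in>V. f j = f i})"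
    by (auto simp: sep V_def)
  then have "card {(i, j) \<in> {1..n} \<times> {1..n}. \<not> separates A (x i) (x j)} = (\<Sum>i\<in>V. N (f i))"
    using V by (simp add: N_def)
  also have "\<dots> = (\<Sum>c\<in>f ` V. \<Sum>i | i \<in> V \<and> f i = c. N (f i))"
    using V by (intro sum.group[symmetric]) auto
  also have "\<dots> = (\<Sum>c\<in>f ` V. N c * N c)"
    by (intro sum.cong refl) (simp add: N_def)
  finally have pairs: "\<epsilon> * real n * (real n - 1) + real n < real (\<Sum>c\<in>f ` V. N c * N c)"
    using bad by (simp add: is_bad_iff)
  have "n = (\<Sum>c\<in>f ` V. \<Sum>i | i \<in> V \<and> f i = c. 1)"
    using V by (subst sum.group) auto
  then have n: "n = (\<Sum>c\<in>f ` V. N c)" by (simp add: N_def)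
  have "real (\<Sum>c\<in>f ` V. N c * N c) = (\<Sum>c\<in>f ` V. real (N c) * real (N c - 1) + real (N c))"
    unfolding of_nat_sum
  proof (rule sum.cong)
    fix c show "real (N c * N c) = real (N c) * real (N c - 1) + real (N c)"
      by (cases "N c") (auto simp: algebra_simps)
  qed simp
  also have "\<dots> = (\<Sum>c\<in>f ` V. real (N c) * real (N c - 1)) + real n"
    by (subst n) (simp add: sum.distrib)
  finally have "\<epsilon> * real n * real (n - 1) \<le> (\<Sum>c\<in>f ` V. real (N c) * real (N c - 1))"
    using pairs \<open>2 \<le> n\<close> by (simp add: of_nat_diff)
  then have frac: "real (card (rainbow_sets f V r)) / real (n choose r) \<le> 2 * exp (- (real r * sqrt \<epsilon> / 64))"
    using rainbow_fraction_le_exp[of V r \<epsilon> f] V assms by (simp add: N_def)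
  have "{js \<in> index_samples n r. key_query (sorted_list_of_set A) (map x js)} =
      {js. length js = r \<and> distinct js \<and> set js \<subseteq> V \<and> inj_on f (set js)}"
    by (auto simp: index_samples_def key_query_iff comp_def distinct_map V_def f_def)
  then have 1: "card {js \<in> index_samples n r. key_query (sorted_list_of_set A) (map x js)}
      = fact r * card (rainbow_sets f V r)"
    using card_distinct_lists[OF V(1), of r "inj_on f"] by (simp add: rainbow_sets_def)
  have 2: "card (index_samples n r) = fact r * (n choose r)"
    using card_distinct_lists[OF V(1), of r "\<lambda>_. True"] n_subsets[OF V(1), of r] V
    by (simp add: index_samples_def V_def)
  have "real (card (rainbow_sets f V r)) \<le> 2 * exp (- (real r * sqrt \<epsilon> / 64)) * real (n choose r)"
    using frac \<open>r \<le> n\<close> by (simp add: pos_divide_le_eq)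
  then have "fact r * real (card (rainbow_sets f V r))
      \<le> fact r * (2 * exp (- (real r * sqrt \<epsilon> / 64)) * real (n choose r))"
    by (intro mult_left_mono) auto
  then show ?thesis unfolding 1 2 by (simp add: mult_ac)
qed

text \<open>The error is one-sided, as a key separates any two sampled tuples. Since
  \<open>192 = 3 * 64\<close>, each of the at most \<open>2 ^ m\<close> bad queries is accepted with
  probability at most \<open>2 * exp (- 3 * m)\<close>, and
  \<open>2 * 2 ^ m \<le> exp (2 * m)\<close>.\<close>

lemma solves_key_filter_sort_filter:
  fixes U :: "'u::linorder set" and \<epsilon> :: real
  assumes "1 \<le> m" "r \<le> n" "0 < \<epsilon>" "\<epsilon> < 1" and r: "192 * real m \<le> real r * sqrt \<epsilon>"
  shows "solves_key_filter sort_filter r U m n \<epsilon> (exp (- real m))"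
  unfolding solves_key_filter_def
proof
  fix x assume "x \<in> data_sets U m n"
  define J where "J = index_samples n r"
  define E where "E = {ans. \<forall>A\<subseteq>{1..m}. correct_answer \<epsilon> n x A (ans A)}"
  define ans where "ans = (\<lambda>js A. key_query (sorted_list_of_set A) (map x js))"
  define F where "F = (\<lambda>A. {js\<in>J. ans js A})"
  have J: "finite J" "card J > 0"
    using finite_index_samples index_samples_nonempty[OF \<open>r \<le> n\<close>] by (auto simp: J_def card_gt_0_iff)
  have "real r * sqrt \<epsilon> \<le> real r * 1" using assms by (intro mult_left_mono) auto
  then have "2 \<le> r" using r \<open>1 \<le> m\<close> by linarith
  then have "2 \<le> n" using \<open>r \<le> n\<close> by simp
  have fail: "js \<in> (\<Union>A\<in>{A\<in>Pow {1..m}. is_bad \<epsilon> n x A}. F A)" if js: "js \<in> J" "ans js \<notin> E" for js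
  proof -
    obtain A where A: "A \<subseteq> {1..m}" "\<not> correct_answer \<epsilon> n x A (ans js A)"
      using js by (auto simp: E_def)
    have "ans js A" if "is_key n x A"
    proof -
      have neq: "map (x i) (sorted_list_of_set A) \<noteq> map (x j) (sorted_list_of_set A)"
        if "i \<in> {1..n}" "j \<in> {1..n}" "i \<noteq> j" for i j
      proof -
        have "separates A (x i) (x j) \<or> separates A (x j) (x i)"
          using \<open>is_key n x A\<close> that unfolding is_key_def by (meson linorder_neqE_nat)
        then obtain a where "a \<in> A" "x i a \<noteq> x j a" unfolding separates_def by metis
        then show ?thesis using finite_subset[OF A(1)] by auto
      qed
      have "inj_on (\<lambda>i. map (x i) (sorted_list_of_set A)) (set js)"
      proof (rule inj_onI, rule ccontr)
        fix i j assume ij: "i \<in> set js" "j \<in> set js" "i \<noteq> j"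
          "map (x i) (sorted_list_of_set A) = map (x j) (sorted_list_of_set A)"
        have "set js \<subseteq> {1..n}" using js(1) by (simp add: J_def index_samples_def)
        then show False using neq[of i j] ij by blast
      qed
      then show ?thesis
        using js(1) by (simp add: ans_def key_query_iff comp_def distinct_map J_def index_samples_def)
    qed
    then have "is_bad \<epsilon> n x A" "ans js A" using A(2) by (auto simp: correct_answer_def)
    then show ?thesis using A(1) js(1) by (auto simp: F_def)
  qed
  have "real (card {js\<in>J. ans js \<notin> E}) \<le> real (card (\<Union>A\<in>{A\<in>Pow {1..m}. is_bad \<epsilon> n x A}. F A))"
    using J(1) fail by (intro of_nat_mono card_mono) (auto simp: F_def)
  also have "\<dots> \<le> real (\<Sum>A\<in>{A\<in>Pow {1..m}. is_bad \<epsilon> n x A}. card (F A))"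
    by (intro of_nat_mono card_UN_le) auto
  also have "\<dots> \<le> (\<Sum>A\<in>{A\<in>Pow {1..m}. is_bad \<epsilon> n x A}. 2 * exp (- (3 * real m)) * real (card J))"
    unfolding of_nat_sum
  proof (rule sum_mono)
    fix A assume A: "A \<in> {A\<in>Pow {1..m}. is_bad \<epsilon> n x A}"
    then have "finite A" using finite_subset[of A "{1..m}"] by auto
    moreover have "1 \<le> real r * sqrt \<epsilon>" using r \<open>1 \<le> m\<close> by linarith
    ultimately have "real (card (F A)) \<le> 2 * exp (- (real r * sqrt \<epsilon> / 64)) * real (card J)"
      using card_rainbow_samples_le[of r n \<epsilon> x A] A assms \<open>2 \<le> n\<close>
      by (simp add: F_def J_def ans_def)
    also have "\<dots> \<le> 2 * exp (- (3 * real m)) * real (card J)"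
      using r by (intro mult_right_mono mult_left_mono) auto
    finally show "real (card (F A)) \<le> 2 * exp (- (3 * real m)) * real (card J)" .
  qed
  also have "\<dots> \<le> (\<Sum>A\<in>Pow {1..m}. 2 * exp (- (3 * real m)) * real (card J))"
    by (rule sum_mono2) auto
  also have "\<dots> = 2 * 2 ^ m * exp (- (3 * real m)) * real (card J)"
    by (simp add: card_Pow)
  also have "\<dots> \<le> exp (- real m) * real (card J)"
  proof (rule mult_right_mono)
    have "(2::real) * 2 ^ m \<le> 2 ^ m * 2 ^ m"
      using \<open>1 \<le> m\<close> power_increasing[of 1 m "2::real"] by (intro mult_right_mono) auto
    also have "\<dots> = 4 ^ m" by (simp flip: power_mult_distrib)
    also have "\<dots> \<le> exp 2 ^ m"
    proof (rule power_mono)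
      have "2 \<le> exp (1::real)" using exp_ge_add_one_self[of 1] by simp
      then have "2 * 2 \<le> exp (1::real) * exp 1" by (intro mult_mono) auto
      then show "4 \<le> exp (2::real)" by (simp flip: exp_add)
    qed simp
    also have "\<dots> = exp (2 * real m)" by (simp add: mult.commute flip: exp_of_nat_mult)
    finally have "2 * 2 ^ m * exp (- (3 * real m)) \<le> exp (2 * real m) * exp (- (3 * real m))"
      by (rule mult_right_mono) simp
    then show "2 * 2 ^ m * exp (- (3 * real m)) \<le> exp (- real m)" by (simp flip: exp_add)
  qed simp
  finally have failures: "real (card {js\<in>J. ans js \<notin> E}) \<le> exp (- real m) * real (card J)" .
  have "{js\<in>J. ans js \<in> E} = J - {js\<in>J. ans js \<notin> E}" by auto
  then have "real (card {js\<in>J. ans js \<in> E}) = real (card J) - real (card {js\<in>J. ans js \<notin> E})"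
    using J(1) by (simp add: card_Diff_subset of_nat_diff card_mono)
  then have "(1 - exp (- real m)) * real (card J) \<le> real (card {js\<in>J. ans js \<in> E})"
    using failures by (simp add: algebra_simps)
  then have "1 - exp (- real m) \<le> real (card {js\<in>J. ans js \<in> E}) / real (card J)"
    using J(2) by (simp only: pos_le_divide_eq of_nat_0_less_iff)
  also have "\<dots> = measure_pmf.prob (answers_pmf sort_filter n r x) E"
  proof -
    have "(\<Sum>js\<in>J. measure_pmf.prob (sort_filter (map x js)) E) = (\<Sum>js\<in>J. if ans js \<in> E then 1 else 0)"
      by (intro sum.cong refl) (simp add: sort_filter_def ans_def indicator_def)
    also have "\<dots> = real (card {js\<in>J. ans js \<in> E})"
      using J(1) by (simp add: sum.If_cases Int_def)
    finally show ?thesis unfolding prob_answers_pmf[OF \<open>r \<le> n\<close>] by (simp add: J_def)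
  qed
  finally show "1 - exp (- real m) \<le> measure_pmf.prob (answers_pmf sort_filter n r x)
      {ans. \<forall>A\<subseteq>{1..m}. correct_answer \<epsilon> n x A (ans A)}" by (simp add: E_def)
qed

text \<open>These bounds guarantee that a sample of \<open>m / sqrt \<epsilon>\<close> tuples is a
  small part of the data and that planted sets of size about \<open>sqrt \<epsilon> * n\<close> are
  large.\<close>

lemma sample_size_bounds:
  fixes \<epsilon> :: real
  assumes "1 \<le> m" "0 < \<epsilon>" "\<epsilon> < 1" and n: "real n \<ge> 192 * real m / \<epsilon>"
  shows "192 * (real m / sqrt \<epsilon>) \<le> sqrt \<epsilon> * real n" "1 \<le> real m / sqrt \<epsilon>"
    "real m / sqrt \<epsilon> \<le> real n / 192"
proof -
  define e where "e = sqrt \<epsilon>"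
  have e: "0 < e" "e \<le> 1" "\<epsilon> = e * e" using assms by (auto simp: e_def)
  have "e * (192 * real m / \<epsilon>) \<le> e * real n"
    using n e by (intro mult_left_mono) auto
  then show 1: "192 * (real m / sqrt \<epsilon>) \<le> sqrt \<epsilon> * real n"
    using e(1) by (simp add: e(3) flip: e_def)
  show "1 \<le> real m / sqrt \<epsilon>"
    using e \<open>1 \<le> m\<close> by (simp add: field_simps flip: e_def)
  have "e * real n \<le> 1 * real n" using e by (intro mult_right_mono) auto
  with 1 show "real m / sqrt \<epsilon> \<le> real n / 192" unfolding e_def[symmetric] by linarith
qed

text \<open>The sample has at most \<open>193 * M\<close> tuples with
  \<open>M \<le> m / \<epsilon>\<close>, so its logarithm exceeds the target logarithm by at most
  \<open>ln 193\<close>. For \<open>m = 1\<close> the latter vanishes as \<open>\<epsilon>\<close>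
  tends to \<open>1\<close>; \<open>\<epsilon> \<le> \<epsilon>\<^sub>0\<close> keeps it at least
  \<open>ln (1 / \<epsilon>\<^sub>0)\<close>, which absorbs additive constants.\<close>

lemma query_time_bound:
  fixes \<epsilon>\<^sub>0 \<epsilon> :: real and x :: "nat \<Rightarrow> 'u::linorder tuple"
  assumes "0 < \<epsilon>" "\<epsilon> \<le> \<epsilon>\<^sub>0" "\<epsilon>\<^sub>0 < 1" "1 \<le> m"
    and js: "js \<in> index_samples n (nat \<lceil>192 * real m / sqrt \<epsilon>\<rceil>)"
    and A: "A \<subseteq> {1..m}" "A \<noteq> {}"
  shows "real (T_key_query (sorted_list_of_set A) (map x js)) \<le>
    17 * 193 * ((1 + ln 193 / ln (3/2)) / ln (1 / \<epsilon>\<^sub>0) + 1 / ln (3/2)) *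
    (real m * real (card A) / sqrt \<epsilon> * ln (real m / \<epsilon>))"
proof -
  define M where "M = real m / sqrt \<epsilon>"
  define r where "r = nat \<lceil>192 * real m / sqrt \<epsilon>\<rceil>"
  define \<Lambda> where "\<Lambda> = ln (real m / \<epsilon>)"
  define l where "l = ln (3 / 2 :: real)"
  have eps: "0 < \<epsilon>" "\<epsilon> < 1" using assms by auto
  have "sqrt \<epsilon> \<le> 1" "sqrt \<epsilon> > 0" using eps by auto
  then have "sqrt \<epsilon> \<le> real m" using \<open>1 \<le> m\<close> by linarith
  then have M: "M \<ge> 1" using \<open>sqrt \<epsilon> > 0\<close> by (simp add: M_def pos_le_divide_eq)
  have l: "l > 0" by (simp add: l_def)
  have r: "192 * M \<le> real r" "real r \<le> 192 * M + 1" using M by (auto simp: r_def M_def)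
  have len: "length js = r" using js by (simp add: index_samples_def r_def)
  have finA: "finite A" using A finite_subset by blast
  have nonempty: "map x js \<noteq> []" "sorted_list_of_set A \<noteq> []" using r M len A finA by auto
  have "\<epsilon> * \<epsilon> \<le> \<epsilon> * 1" using eps by (intro mult_left_mono) auto
  then have "\<epsilon> \<le> sqrt \<epsilon>" by (intro real_le_rsqrt) (simp add: power2_eq_square)
  then have Mle: "M \<le> real m / \<epsilon>" unfolding M_def using eps by (intro divide_left_mono) auto
  have ratio: "1 < 1 / \<epsilon>\<^sub>0" "1 / \<epsilon>\<^sub>0 \<le> real m / \<epsilon>"
    using assms by (auto intro: frac_le)
  have L: "0 < ln (1 / \<epsilon>\<^sub>0)" using ratio(1) by (rule ln_gt_zero)
  have "0 < 1 / \<epsilon>\<^sub>0" "0 < real m / \<epsilon>" using ratio by linarith+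
  then have L': "ln (1 / \<epsilon>\<^sub>0) \<le> \<Lambda>"
    unfolding \<Lambda>_def using ratio(2) ln_le_cancel_iff by blast
  have "real r \<le> 193 * M" using r M by simp
  moreover have "real r \<ge> 1" using r M by simp
  ultimately have "ln (real r) \<le> ln (193 * M)" using M by (subst ln_le_cancel_iff) auto
  also have "\<dots> = ln 193 + ln M" using M by (subst ln_mult) auto
  also have "ln M \<le> \<Lambda>"
    unfolding \<Lambda>_def using M Mle by (subst ln_le_cancel_iff) auto
  finally have lnr: "ln (real r) \<le> ln 193 + \<Lambda>" by simp
  have "1 + log (3/2) (real r) = 1 + ln (real r) / l" by (simp add: log_def l_def)
  also have "\<dots> \<le> 1 + (ln 193 + \<Lambda>) / l" using lnr l by (simp add: divide_right_mono)
  also have "\<dots> = (1 + ln 193 / l) * 1 + \<Lambda> / l" by (simp add: add_divide_distrib)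
  also have "\<dots> \<le> (1 + ln 193 / l) * (\<Lambda> / ln (1 / \<epsilon>\<^sub>0)) + \<Lambda> / l"
    using L L' l by (intro add_right_mono mult_left_mono) (auto simp: pos_le_divide_eq)
  also have "\<dots> = ((1 + ln 193 / l) / ln (1 / \<epsilon>\<^sub>0) + 1 / l) * \<Lambda>"
  proof -
    have "q * (\<Lambda> / d) + \<Lambda> / l = (q / d + 1 / l) * \<Lambda>" for q d
      by (simp add: algebra_simps)
    then show ?thesis .
  qed
  finally have log: "1 + log (3/2) (real r) \<le> ((1 + ln 193 / l) / ln (1 / \<epsilon>\<^sub>0) + 1 / l) * \<Lambda>" .
  have "log (3/2) (real r) \<ge> 0" using \<open>real r \<ge> 1\<close> by simp
  have "real (T_key_query (sorted_list_of_set A) (map x js))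
      \<le> 17 * real (card A) * real r * (1 + log (3/2) (real r))"
    using T_key_query_le[OF nonempty] by (simp add: len)
  also have "\<dots> \<le> 17 * real (card A) * (193 * M) * (((1 + ln 193 / l) / ln (1 / \<epsilon>\<^sub>0) + 1 / l) * \<Lambda>)"
    using log \<open>real r \<le> 193 * M\<close> \<open>log (3/2) (real r) \<ge> 0\<close> M by (intro mult_mono) auto
  finally show ?thesis by (simp add: M_def \<Lambda>_def l_def mult_ac)
qed

section \<open>Necessity\<close>

text \<open>In the main case a single coordinate already forces
  \<open>E \<le> 2 * exp (- m)\<close>, whereas a smaller sample makes the exponent in
  \<open>E\<close> at most \<open>m / 4\<close>; this contradicts
  \<open>ln 2 < 3 / 4\<close>.\<close>

lemma sample_size_ge_linear:
  fixes alg :: "'u filter_alg" and \<epsilon>\<^sub>0 \<epsilon> :: real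
  assumes "1 \<le> m" "0 < \<epsilon>" "\<epsilon> \<le> \<epsilon>\<^sub>0" "\<epsilon>\<^sub>0 < 1" "real n \<ge> 192 * real m / \<epsilon>"
    and U: "infinite U \<or> n \<le> card U" and "r \<le> n"
    and solves: "solves_key_filter alg r U m n \<epsilon> (exp (- real m))"
  shows "real r \<ge> (1 - sqrt \<epsilon>\<^sub>0) / 32 * (real m / sqrt \<epsilon>)"
proof (rule ccontr)
  assume less: "\<not> ?thesis"
  define \<gamma> where "\<gamma> = 1 - sqrt \<epsilon>\<^sub>0"
  define M where "M = real m / sqrt \<epsilon>"
  have r: "real r < \<gamma> / 32 * M" using less by (simp add: \<gamma>_def M_def)
  have \<gamma>: "0 < \<gamma>" "\<gamma> \<le> 1" "sqrt \<epsilon> \<le> 1 - \<gamma>" using assms by (auto simp: \<gamma>_def)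
  have M: "192 * M \<le> sqrt \<epsilon> * real n" "1 \<le> M" "M \<le> real n / 192"
    using sample_size_bounds[of m \<epsilon> n] assms by (auto simp: M_def)
  have m: "real m \<ge> 1" using \<open>1 \<le> m\<close> by simp
  have ln2: "ln (2::real) \<le> 3 / 4" using ln2_le_25_over_36 by simp
  have "\<gamma> / 32 * M \<le> \<gamma> / 32 * (real n / 192)" using \<gamma> M by (intro mult_left_mono) auto
  with r have "real r < \<gamma> / 32 * (real n / 192)" by (rule less_le_trans)
  then have r': "real r < \<gamma> * real n / 6144" by simp
  show False
  proof (cases "8 \<le> \<gamma> * real n")
    case True
    define E where "E = exp (- (8 * real r * sqrt \<epsilon> / \<gamma>))"
    have E: "0 < E" "E \<le> 1" using \<gamma> \<open>0 < \<epsilon>\<close> by (auto simp: E_def)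
    have "1 - exp (- real m) \<le> (1 - E / 2) ^ m"
      unfolding E_def using M r' True
      by (intro solves_key_filter_exp_le[OF solves U \<open>0 < \<epsilon>\<close> \<gamma>(3) _ \<gamma>(1)]) auto
    also have "\<dots> \<le> (1 - E / 2) ^ 1" using E \<open>1 \<le> m\<close> by (intro power_decreasing) auto
    finally have "E \<le> 2 * exp (- real m)" by simp
    then have "ln E \<le> ln (2 * exp (- real m))" using E by (subst ln_le_cancel_iff) auto
    then have "real m - ln 2 \<le> 8 * real r * sqrt \<epsilon> / \<gamma>" by (simp add: E_def ln_mult)
    also have "\<dots> \<le> 8 * (\<gamma> / 32 * M) * sqrt \<epsilon> / \<gamma>"
      using r \<gamma> \<open>0 < \<epsilon>\<close> by (intro divide_right_mono mult_right_mono mult_left_mono) auto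
    also have "\<dots> = real m / 4" using \<gamma> \<open>0 < \<epsilon>\<close> by (simp add: M_def)
    finally have "3 / 4 * real m \<le> ln 2" by simp
    moreover have "ln 2 < (3 / 4 :: real)" using ln2_le_25_over_36 by simp
    ultimately show False using m by linarith
  next
    case False
    \<comment> \<open>Here \<open>r < 8 / 6144\<close>. An empty sample is refuted by planting all
      \<open>n\<close> indices: the filter guesses blindly and succeeds with probability at most
      \<open>1 / 2\<close>.\<close>
    then have "r = 0" using r' by simp
    have n: "real n \<ge> 192" using M by simp
    obtain u where u: "u ` {1..n} \<subseteq> U" "inj_on u {1..n}"
      using obtain_distinct_values[OF U] by blast
    have "1 - exp (- real m) \<le> (1 - real (n - r choose n) / real (n choose n) / 2) ^ m"
    proof (rule solves_key_filter_imp_le[OF solves u])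
      have "\<epsilon> * (real n * (real n - 1)) < 1 * (real n * (real n - 1))"
        using assms n by (intro mult_strict_right_mono) auto
      then show "\<epsilon> * real n * (real n - 1) < real n * (real n - 1)" by (simp add: mult.assoc)
    qed (use \<open>r \<le> n\<close> in auto)
    also have "\<dots> = (1 / 2) ^ m" by (simp add: \<open>r = 0\<close>)
    also have "\<dots> \<le> (1 / 2) ^ 1" using \<open>1 \<le> m\<close> by (intro power_decreasing) auto
    finally have "exp (ln (1 / 2)) \<le> exp (- real m)" by simp
    then have "real m \<le> ln 2" by (simp add: ln_div)
    then show False using m ln2 by linarith
  qed
qed

text \<open>By \<open>1 - E / 2 \<le> exp (- E / 2)\<close>, success forces
  \<open>m * E \<le> D\<close>. A smaller sample has exponent at most
  \<open>sqrt (ln m) / 4 \<le> ln m / 2\<close>, hence \<open>E \<ge> 1 / sqrt m\<close> and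
  \<open>sqrt m \<le> D\<close>, which fails for large \<open>m\<close>.\<close>

lemma sample_size_ge_sqrt_ln:
  fixes \<epsilon>\<^sub>0 \<delta> :: real
  assumes "0 < \<epsilon>\<^sub>0" "\<epsilon>\<^sub>0 < 1" "\<delta> < 1"
  obtains m\<^sub>0 where "\<And>(alg :: 'u filter_alg) U r m n \<epsilon>.
    m\<^sub>0 \<le> m \<Longrightarrow> 0 < \<epsilon> \<Longrightarrow> \<epsilon> \<le> \<epsilon>\<^sub>0 \<Longrightarrow> real n \<ge> 192 * real m / \<epsilon> \<Longrightarrow>
    infinite U \<or> n \<le> card U \<Longrightarrow> solves_key_filter alg r U m n \<epsilon> \<delta> \<Longrightarrow>
    real r \<ge> (1 - sqrt \<epsilon>\<^sub>0) / 32 * sqrt (ln (real m) / \<epsilon>)"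
proof
  define \<gamma> where "\<gamma> = 1 - sqrt \<epsilon>\<^sub>0"
  define D where "D = - 2 * ln (1 - \<delta>)"
  have \<gamma>: "0 < \<gamma>" "\<gamma> \<le> 1" using assms by (auto simp: \<gamma>_def)
  fix alg :: "'u filter_alg" and U r m n \<epsilon>
  \<comment> \<open>In the threshold, \<open>D\<^sup>2\<close> refutes
    \<open>sqrt m \<le> D\<close>, \<open>8 / \<gamma>\<close> ensures
    \<open>\<gamma> * n \<ge> 8\<close>, and \<open>3\<close> ensures
    \<open>ln m \<ge> 1\<close>.\<close>
  assume m: "nat \<lceil>8 / \<gamma> + D\<^sup>2\<rceil> + 3 \<le> m" and eps: "0 < \<epsilon>" "\<epsilon> \<le> \<epsilon>\<^sub>0"
    and n: "real n \<ge> 192 * real m / \<epsilon>" and U: "infinite U \<or> n \<le> card U"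
    and solves: "solves_key_filter alg r U m n \<epsilon> \<delta>"
  show "real r \<ge> (1 - sqrt \<epsilon>\<^sub>0) / 32 * sqrt (ln (real m) / \<epsilon>)"
  proof (rule ccontr)
    assume "\<not> ?thesis"
    then have r: "real r < \<gamma> / 32 * (sqrt (ln (real m)) / sqrt \<epsilon>)"
      by (simp add: \<gamma>_def real_sqrt_divide)
    have m3: "real m \<ge> 3" using m by simp
    have mlarge: "real m > 8 / \<gamma> + D\<^sup>2" using m by linarith
    have "exp 1 \<le> real m" using exp_le m3 by linarith
    then have "ln (exp 1) \<le> ln (real m)" using m3 by (subst ln_le_cancel_iff) auto
    then have lnm: "1 \<le> ln (real m)" by simp
    have "sqrt (ln (real m)) \<le> sqrt ((ln (real m))\<^sup>2)"
      using lnm by (intro real_sqrt_le_mono) (simp add: power2_eq_square)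
    then have sqrt_ln: "sqrt (ln (real m)) \<le> ln (real m)" using lnm by simp
    also have ln_le: "ln (real m) \<le> real m" using m3 ln_le_minus_one[of "real m"] by linarith
    finally have "sqrt (ln (real m)) \<le> real m" .
    then have "\<gamma> / 32 * (sqrt (ln (real m)) / sqrt \<epsilon>) \<le> \<gamma> / 32 * (real m / sqrt \<epsilon>)"
      using \<gamma> eps by (intro mult_left_mono divide_right_mono) auto
    moreover have M: "192 * (real m / sqrt \<epsilon>) \<le> sqrt \<epsilon> * real n" "1 \<le> real m / sqrt \<epsilon>"
        "real m / sqrt \<epsilon> \<le> real n / 192"
      using sample_size_bounds[of m \<epsilon> n] assms eps n m by auto
    moreover have "\<gamma> / 32 * (real m / sqrt \<epsilon>) \<le> \<gamma> / 32 * (real n / 192)"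
      using \<gamma> M by (intro mult_left_mono) auto
    ultimately have "real r < \<gamma> / 32 * (real n / 192)" using r by linarith
    moreover have "\<gamma> * real n \<ge> 0" using \<gamma> by simp
    ultimately have r': "real r \<le> \<gamma> * real n / 4" by simp
    have "real m * sqrt \<epsilon> \<le> real m * 1" using eps assms by (intro mult_left_mono) auto
    then have "real m \<le> real m / sqrt \<epsilon>" using eps by (simp add: pos_le_divide_eq)
    then have "real m \<le> real n" using M(3) by linarith
    moreover have "8 / \<gamma> \<le> real m" using mlarge zero_le_power2[of D] by linarith
    ultimately have "8 / \<gamma> \<le> real n" by linarith
    then have n8: "8 \<le> \<gamma> * real n" using \<gamma> by (simp add: field_simps)
    define E where "E = exp (- (8 * real r * sqrt \<epsilon> / \<gamma>))"
    have E: "0 < E" "E \<le> 1" using \<gamma> eps by (auto simp: E_def)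
    have "1 - \<delta> \<le> (1 - E / 2) ^ m"
      unfolding E_def
    proof (rule solves_key_filter_exp_le[OF solves U eps(1) _ _ \<gamma>(1) n8 r'])
      show "2 \<le> sqrt \<epsilon> * real n" using M(1,2) by linarith
      show "sqrt \<epsilon> \<le> 1 - \<gamma>" using eps by (simp add: \<gamma>_def)
    qed
    also have "\<dots> \<le> exp (- (E / 2)) ^ m"
      using E exp_ge_add_one_self[of "- (E / 2)"] by (intro power_mono) auto
    also have "\<dots> = exp (- (real m * E / 2))" by (simp flip: exp_of_nat_mult)
    finally have "ln (1 - \<delta>) \<le> ln (exp (- (real m * E / 2)))"
      using assms by (subst ln_le_cancel_iff) auto
    then have ED: "real m * E \<le> D" by (simp add: D_def)
    have "8 * real r * sqrt \<epsilon> / \<gamma> \<le> 8 * (\<gamma> / 32 * (sqrt (ln (real m)) / sqrt \<epsilon>)) * sqrt \<epsilon> / \<gamma>"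
      using r \<gamma> eps by (intro divide_right_mono mult_right_mono mult_left_mono) auto
    also have "\<dots> = sqrt (ln (real m)) / 4" using \<gamma> eps by simp
    also have "\<dots> \<le> ln (real m) / 2" using sqrt_ln lnm by simp
    also have "\<dots> = ln (sqrt (real m))" using m3 by (simp add: ln_sqrt)
    finally have "exp (- ln (sqrt (real m))) \<le> E" by (simp add: E_def)
    then have "1 / sqrt (real m) \<le> E" using m3 by (simp add: exp_minus divide_inverse)
    then have "real m * (1 / sqrt (real m)) \<le> real m * E" by (intro mult_left_mono) auto
    also have "real m * (1 / sqrt (real m)) = sqrt (real m)" using m3 by (simp add: real_div_sqrt)
    finally have "sqrt (real m) \<le> D" using ED by simp
    then have "(sqrt (real m))\<^sup>2 \<le> D\<^sup>2" by (intro power_mono) auto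
    then have "real m \<le> D\<^sup>2" by simp
    moreover have "0 < 8 / \<gamma>" using \<gamma> by simp
    ultimately show False using mlarge by linarith
  qed
qed

text \<open>\<open>K\<close> and \<open>C\<close> are absolute. The other constants depend on
  \<open>\<epsilon>\<^sub>0\<close>: as \<open>\<epsilon>\<close> approaches \<open>1\<close>, the
  lower bounds obtained here weaken like \<open>1 - sqrt \<epsilon>\<^sub>0\<close>, and the
  logarithm in the query time can vanish. In the proof \<open>\<delta>\<close> affects only
  \<open>m\<^sub>0\<close>.\<close>

theorem theorem1:
  shows "\<exists>K>0. \<exists>C>0.
    \<comment> \<open>sufficiency\<close>
    (\<forall>(U :: 'u::linorder set) m n (\<epsilon>::real).
       1 \<le> m \<and> 0 < \<epsilon> \<and> \<epsilon> < 1 \<and> real n \<ge> K * real m / \<epsilon> \<longrightarrow>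
         nat \<lceil>C * real m / sqrt \<epsilon>\<rceil> \<le> n \<and>
         solves_key_filter sort_filter (nat \<lceil>C * real m / sqrt \<epsilon>\<rceil>) U m n \<epsilon> (exp (- real m))) \<and>
    (\<forall>\<epsilon>\<^sub>0. 0 < \<epsilon>\<^sub>0 \<and> \<epsilon>\<^sub>0 < 1 \<longrightarrow>
       \<comment> \<open>query time\<close>
       (\<exists>B>0. \<forall>(U :: 'u set) m n \<epsilon>.
          1 \<le> m \<and> 0 < \<epsilon> \<and> \<epsilon> \<le> \<epsilon>\<^sub>0 \<and> real n \<ge> K * real m / \<epsilon> \<longrightarrow>
          (\<forall>x\<in>data_sets U m n. \<forall>js\<in>index_samples n (nat \<lceil>C * real m / sqrt \<epsilon>\<rceil>).
             \<forall>A\<subseteq>{1..m}. A \<noteq> {} \<longrightarrow>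
               real (T_key_query (sorted_list_of_set A) (map x js))
                 \<le> B * (real m * real (card A) / sqrt \<epsilon> * ln (real m / \<epsilon>)))) \<and>
       \<comment> \<open>necessity for failure probability at most exp(-m)\<close>
       (\<exists>c>0. \<forall>(U :: 'u set) m n \<epsilon>.
          1 \<le> m \<and> 0 < \<epsilon> \<and> \<epsilon> \<le> \<epsilon>\<^sub>0 \<and> real n \<ge> K * real m / \<epsilon> \<and> (infinite U \<or> n \<le> card U) \<longrightarrow>
          (\<forall>r\<le>n. \<forall>alg. solves_key_filter alg r U m n \<epsilon> (exp (- real m)) \<longrightarrow>
             real r \<ge> c * (real m / sqrt \<epsilon>))) \<and>
       \<comment> \<open>necessity for constant failure probability\<close>
       (\<forall>\<delta>. 0 < \<delta> \<and> \<delta> < 1 \<longrightarrow>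
          (\<exists>c>0. \<exists>m\<^sub>0. \<forall>(U :: 'u set) m n \<epsilon>.
             1 \<le> m \<and> m\<^sub>0 \<le> m \<and> 0 < \<epsilon> \<and> \<epsilon> \<le> \<epsilon>\<^sub>0 \<and> real n \<ge> K * real m / \<epsilon> \<and>
             (infinite U \<or> n \<le> card U) \<longrightarrow>
             (\<forall>r\<le>n. \<forall>alg. solves_key_filter alg r U m n \<epsilon> \<delta> \<longrightarrow>
                real r \<ge> c * sqrt (ln (real m) / \<epsilon>)))))"
proof (rule exI[of _ "192::real"], rule conjI, simp, rule exI[of _ "192::real"], intro conjI allI impI)
  fix U :: "'u set" and m n and \<epsilon> :: real
  assume *: "1 \<le> m \<and> 0 < \<epsilon> \<and> \<epsilon> < 1 \<and> real n \<ge> 192 * real m / \<epsilon>"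
  \<comment> \<open>\<open>C = 192\<close> comes from the union bound; with \<open>K = C\<close> the
    sample fits into the data because
    \<open>m / sqrt \<epsilon> \<le> m / \<epsilon>\<close>.\<close>
  define r where "r = nat \<lceil>192 * real m / sqrt \<epsilon>\<rceil>"
  have "192 * real m / sqrt \<epsilon> \<le> real n"
    using sample_size_bounds(3)[of m \<epsilon> n] * by (subst times_divide_eq_right[symmetric]) linarith
  then show "nat \<lceil>192 * real m / sqrt \<epsilon>\<rceil> \<le> n" by (simp add: ceiling_le_iff)
  then have "r \<le> n" by (simp add: r_def)
  have "192 * real m / sqrt \<epsilon> \<le> real r" unfolding r_def by linarith
  then have "192 * real m \<le> real r * sqrt \<epsilon>" using * by (simp add: field_simps)
  with * \<open>r \<le> n\<close> show "solves_key_filter sort_filter (nat \<lceil>192 * real m / sqrt \<epsilon>\<rceil>) U m n \<epsilon> (exp (- real m))"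
    unfolding r_def by (intro solves_key_filter_sort_filter) auto
next
  fix \<epsilon>\<^sub>0 :: real
  assume \<epsilon>\<^sub>0: "0 < \<epsilon>\<^sub>0 \<and> \<epsilon>\<^sub>0 < 1"
  define B :: real where "B = 17 * 193 * ((1 + ln 193 / ln (3/2)) / ln (1 / \<epsilon>\<^sub>0) + 1 / ln (3/2))"
  have "ln (1 / \<epsilon>\<^sub>0) > 0" using \<epsilon>\<^sub>0 by (intro ln_gt_zero) auto
  then have "B > 0"
    unfolding B_def by (intro mult_pos_pos add_pos_pos divide_pos_pos) auto
  show "\<exists>B>0. \<forall>(U :: 'u set) m n \<epsilon>.
      1 \<le> m \<and> 0 < \<epsilon> \<and> \<epsilon> \<le> \<epsilon>\<^sub>0 \<and> real n \<ge> 192 * real m / \<epsilon> \<longrightarrow>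
      (\<forall>x\<in>data_sets U m n. \<forall>js\<in>index_samples n (nat \<lceil>192 * real m / sqrt \<epsilon>\<rceil>).
         \<forall>A\<subseteq>{1..m}. A \<noteq> {} \<longrightarrow>
           real (T_key_query (sorted_list_of_set A) (map x js))
             \<le> B * (real m * real (card A) / sqrt \<epsilon> * ln (real m / \<epsilon>)))"
  proof (intro exI[of _ B] conjI allI impI ballI)
    fix U :: "'u set" and m n \<epsilon> x js A
    assume "1 \<le> m \<and> 0 < \<epsilon> \<and> \<epsilon> \<le> \<epsilon>\<^sub>0 \<and> real n \<ge> 192 * real m / \<epsilon>"
      "js \<in> index_samples n (nat \<lceil>192 * real m / sqrt \<epsilon>\<rceil>)" "A \<subseteq> {1..m}" "A \<noteq> {}"
    then show "real (T_key_query (sorted_list_of_set A) (map x js))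
        \<le> B * (real m * real (card A) / sqrt \<epsilon> * ln (real m / \<epsilon>))"
      unfolding B_def using \<epsilon>\<^sub>0 query_time_bound by blast
  qed (fact \<open>B > 0\<close>)
  define c where "c = (1 - sqrt \<epsilon>\<^sub>0) / 32"
  have c: "c > 0" using \<epsilon>\<^sub>0 by (simp add: c_def)
  show "\<exists>c>0. \<forall>(U :: 'u set) m n \<epsilon>.
      1 \<le> m \<and> 0 < \<epsilon> \<and> \<epsilon> \<le> \<epsilon>\<^sub>0 \<and> real n \<ge> 192 * real m / \<epsilon> \<and> (infinite U \<or> n \<le> card U) \<longrightarrow>
      (\<forall>r\<le>n. \<forall>alg. solves_key_filter alg r U m n \<epsilon> (exp (- real m)) \<longrightarrow>
         real r \<ge> c * (real m / sqrt \<epsilon>))"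
  proof (intro exI[of _ c] conjI allI impI c)
    fix U :: "'u set" and m n \<epsilon> r and alg :: "'u filter_alg"
    assume "1 \<le> m \<and> 0 < \<epsilon> \<and> \<epsilon> \<le> \<epsilon>\<^sub>0 \<and> real n \<ge> 192 * real m / \<epsilon> \<and> (infinite U \<or> n \<le> card U)"
      "r \<le> n" "solves_key_filter alg r U m n \<epsilon> (exp (- real m))"
    then show "real r \<ge> c * (real m / sqrt \<epsilon>)"
      unfolding c_def using \<epsilon>\<^sub>0 sample_size_ge_linear by blast
  qed
  fix \<delta> :: real
  assume "0 < \<delta> \<and> \<delta> < 1"
  then obtain m\<^sub>0 where m\<^sub>0: "\<And>(alg :: 'u filter_alg) U r m n \<epsilon>.
      m\<^sub>0 \<le> m \<Longrightarrow> 0 < \<epsilon> \<Longrightarrow> \<epsilon> \<le> \<epsilon>\<^sub>0 \<Longrightarrow> real n \<ge> 192 * real m / \<epsilon> \<Longrightarrow>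
      infinite U \<or> n \<le> card U \<Longrightarrow> solves_key_filter alg r U m n \<epsilon> \<delta> \<Longrightarrow>
      real r \<ge> c * sqrt (ln (real m) / \<epsilon>)"
    using sample_size_ge_sqrt_ln[of \<epsilon>\<^sub>0 \<delta>] \<epsilon>\<^sub>0 unfolding c_def by blast
  show "\<exists>c>0. \<exists>m\<^sub>0. \<forall>(U :: 'u set) m n \<epsilon>.
      1 \<le> m \<and> m\<^sub>0 \<le> m \<and> 0 < \<epsilon> \<and> \<epsilon> \<le> \<epsilon>\<^sub>0 \<and> real n \<ge> 192 * real m / \<epsilon> \<and>
      (infinite U \<or> n \<le> card U) \<longrightarrow>
      (\<forall>r\<le>n. \<forall>alg. solves_key_filter alg r U m n \<epsilon> \<delta> \<longrightarrow>
         real r \<ge> c * sqrt (ln (real m) / \<epsilon>))"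
    using c m\<^sub>0 by (intro exI[of _ c] exI[of _ m\<^sub>0]) blast
qed simp_all

end
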